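(* Let $T$ be a finite subset of $\mathbb{R}^d$, let $\mathcal{F}$ be a countable family of $2d$-variate real analytic functions that respects $T$, and let $\alpha>0$. Then there exists a finite set $X\subset\mathbb{R}^d$ such that $\mathcal{F}$ respects $X$ and every subset of $X$ of size at least $\alpha|X|$ contains a homothetic copy of $T$.
   Context: A homothetic map in $\mathbb{R}^d$ is a map $h:\mathbb{R}^d\to\mathbb{R}^d$ of the form $h(p)=p^*+\lambda p$ for some $p^*\in\mathbb{R}^d$ and $\lambda>0$; a set $T'$ is a homothetic copy of $T$ if $T'=h(T)$ for some homothetic map $h$. A family $\mathcal{F}$ of functions $\mathbb{R}^{2d}\to\mathbb{R}$ respects a set $X\subset\mathbb{R}^d$ if $f(p,q)\neq 0$ for all $f\in\mathcal{F}$ and all pairs of distinct points $p,q\in X$. *)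

theory Defs
  imports "HOL-Analysis.Analysis"
begin

definition homothetic_map :: "(('a::real_vector) \<Rightarrow> 'a) \<Rightarrow> bool" where
  "homothetic_map h \<longleftrightarrow> (\<exists>v c. c > 0 \<and> h = (\<lambda>p. v + c *\<^sub>R p))"

definition homothetic_copy :: "('a::real_vector) set \<Rightarrow> 'a set \<Rightarrow> bool" where
  "homothetic_copy T' T \<longleftrightarrow> (\<exists>h. homothetic_map h \<and> T' = h ` T)"

text \<open>A function of several real variables is real analytic if around every point of the space
  it is the sum of a convergent power series. A multi-index assigns an exponent to each vector of
  the standard basis (and is \<^const>\<open>undefined\<close> elsewhere). Summation over multi-indices is
  unconditional, which for real series means absolute.\<close>

definition multi_indices :: "(('a::euclidean_space) \<Rightarrow> nat) set" where
  "multi_indices = Basis \<rightarrow>\<^sub>E UNIV"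

definition monomial :: "(('a::euclidean_space) \<Rightarrow> nat) \<Rightarrow> 'a \<Rightarrow> real" where
  "monomial k x = (\<Prod>b\<in>Basis. (x \<bullet> b) ^ k b)"

definition real_analytic_at :: "(('a::euclidean_space) \<Rightarrow> real) \<Rightarrow> 'a \<Rightarrow> bool" where
  "real_analytic_at f a \<longleftrightarrow>
     (\<exists>r>0. \<exists>c. \<forall>x\<in>ball a r. ((\<lambda>k. c k * monomial k (x - a)) has_sum f x) multi_indices)"

definition real_analytic :: "(('a::euclidean_space) \<Rightarrow> real) \<Rightarrow> bool" where
  "real_analytic f \<longleftrightarrow> (\<forall>a. real_analytic_at f a)"

text \<open>A \<open>2d\<close>-variate function is a function on \<open>\<real>\<^sup>d \<times> \<real>\<^sup>d\<close>, whose standard basis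
  consists of \<open>2d\<close> vectors.\<close>

definition family_respects :: "('a \<times> 'a \<Rightarrow> real) set \<Rightarrow> 'a set \<Rightarrow> bool" where
  "family_respects \<F> X \<longleftrightarrow> (\<forall>f\<in>\<F>. \<forall>p\<in>X. \<forall>q\<in>X. p \<noteq> q \<longrightarrow> f (p, q) \<noteq> 0)"

end

theory Submission
  imports Defs "HOL-Complex_Analysis.Cauchy_Integral_Formula"
begin

text \<open>Let \<open>T = {t\<^sub>1, \<dots>, t\<^sub>k}\<close>. The set \<open>X\<close> consists of the points \<open>\<Sum>i x\<^sub>i w\<^sub>i\<close>, where \<open>w\<close> runs over
  the words of length \<open>n\<close> over \<open>T\<close> and the scalars \<open>x\<^sub>i > 0\<close> are generic. A combinatorial line is mapped
  to a homothetic copy of \<open>T\<close>, so for large \<open>n\<close> the density Hales-Jewett theorem finds such a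
  copy in every dense subset. For distinct words \<open>w\<close>, \<open>w'\<close> the value of \<open>f\<close> at the
  corresponding pair of points is an analytic function of \<open>x\<close>, and it does not vanish
  identically since \<open>f (w\<^sub>i, w'\<^sub>i) \<noteq> 0\<close> at the unit vector of a coordinate \<open>i\<close> with \<open>w\<^sub>i \<noteq> w'\<^sub>i\<close>. On
  a line parallel to an axis such a function vanishes everywhere or only countably often, and
  so the coordinates of a generic \<open>x\<close> can be chosen one after the other.

  The density Hales-Jewett theorem is proved by induction on \<open>k\<close>, following Dodos, Kanellopoulos
  and Tyros. Let \<open>A\<close> be a line-free set of words over \<open>k + 1\<close> letters. The theorem for \<open>k\<close> letters
  and a Graham-Rothschild argument yield a subspace in which the density of \<open>A\<close> is hardly smaller
  and where, on average over its translates, a positive proportion of the words \<open>x\<close> are such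
  that replacing the last letter by any of the others leads into \<open>A\<close>. This set of words is an
  intersection of \<open>k\<close> insensitive sets and is nearly disjoint from \<open>A\<close>, so \<open>A\<close> is denser on its
  complement. Insensitive sets are nearly partitioned by large subspaces, and therefore \<open>A\<close> has
  increased density on some large subspace.\<close>

section \<open>Words, averages and combinatorial subspaces\<close>

definition words :: "nat \<Rightarrow> nat \<Rightarrow> nat list set" where
  "words k n = {w. set w \<subseteq> {..<k} \<and> length w = n}"

lemma finite_words [simp]: "finite (words k n)"
  unfolding words_def by (rule finite_lists_length_eq) simp

lemma card_words [simp]: "card (words k n) = k ^ n"
  unfolding words_def by (subst card_lists_length_eq) auto

lemma words_length: "w \<in> words k n \<Longrightarrow> length w = n"
  by (simp add: words_def)

lemma words_nth: "w \<in> words k n \<Longrightarrow> j < n \<Longrightarrow> w ! j < k"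
  by (auto simp: words_def subset_iff)

lemma words_mono: "k \<le> k' \<Longrightarrow> words k n \<subseteq> words k' n"
  by (auto simp: words_def)

lemma words_0 [simp]: "words k 0 = {[]}"
  by (auto simp: words_def)

lemma words_append: "u \<in> words k m \<Longrightarrow> v \<in> words k n \<Longrightarrow> u @ v \<in> words k (m + n)"
  by (auto simp: words_def)

lemma words_Cons_iff [simp]: "a # w \<in> words k (Suc n) \<longleftrightarrow> a < k \<and> w \<in> words k n"
  by (auto simp: words_def)

lemma words_SucE:
  assumes "w \<in> words k (Suc n)"
  obtains a u where "w = a # u" "a < k" "u \<in> words k n"
  using assms by (cases w) (auto simp: words_def)

lemma words_snocE:
  assumes "w \<in> words k (Suc n)"
  obtains a u where "w = u @ [a]" "a < k" "u \<in> words k n"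
  using assms by (cases w rule: rev_cases) (auto simp: words_def)

lemma words_snoc [simp]: "w @ [a] \<in> words k (Suc n) \<longleftrightarrow> a < k \<and> w \<in> words k n"
  by (auto simp: words_def)

lemma words_sum_append:
  "sum f (words k (m + n)) = (\<Sum>u\<in>words k m. \<Sum>v\<in>words k n. f (u @ v))"
proof -
  have "(\<Sum>u\<in>words k m. \<Sum>v\<in>words k n. f (u @ v)) =
      (\<Sum>(u, v)\<in>words k m \<times> words k n. f (u @ v))"
    by (simp add: sum.cartesian_product)
  also have "\<dots> = sum f (words k (m + n))"
    by (rule sum.reindex_bij_witness[where j = "\<lambda>(u, v). u @ v"
          and i = "\<lambda>w. (take m w, drop m w)"])
      (auto simp: words_def dest: in_set_takeD in_set_dropD)
  finally show ?thesis ..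
qed

section \<open>Normalised averages over words\<close>

definition avg :: "nat \<Rightarrow> nat \<Rightarrow> (nat list \<Rightarrow> real) \<Rightarrow> real" where
  "avg k n f = (\<Sum>w\<in>words k n. f w) / real k ^ n"

lemma avg_cong: "(\<And>w. w \<in> words k n \<Longrightarrow> f w = g w) \<Longrightarrow> avg k n f = avg k n g"
  unfolding avg_def by (metis (no_types, lifting) sum.cong)

lemma avg_mono: "(\<And>w. w \<in> words k n \<Longrightarrow> f w \<le> g w) \<Longrightarrow> avg k n f \<le> avg k n g"
  unfolding avg_def by (intro divide_right_mono sum_mono) auto

lemma avg_const [simp]: "k > 0 \<Longrightarrow> avg k n (\<lambda>_. c) = c"
  by (simp add: avg_def)

lemma avg_add: "avg k n (\<lambda>w. f w + g w) = avg k n f + avg k n g"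
  by (simp add: avg_def sum.distrib add_divide_distrib)

lemma avg_diff: "avg k n (\<lambda>w. f w - g w) = avg k n f - avg k n g"
  by (simp add: avg_def sum_subtractf diff_divide_distrib)

lemma avg_cmult: "avg k n (\<lambda>w. c * f w) = c * avg k n f"
  by (simp add: avg_def sum_distrib_left)

lemma avg_sum: "avg k n (\<lambda>w. \<Sum>i\<in>I. f i w) = (\<Sum>i\<in>I. avg k n (f i))"
  unfolding avg_def by (subst sum.swap) (simp add: sum_divide_distrib)

lemma avg_append: "avg k (m + n) f = avg k m (\<lambda>u. avg k n (\<lambda>v. f (u @ v)))"
  by (simp add: avg_def words_sum_append power_add sum_divide_distrib mult.commute)

lemma avg_swap: "avg k m (\<lambda>u. avg l n (f u)) = avg l n (\<lambda>v. avg k m (\<lambda>u. f u v))"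
  unfolding avg_def
  by (simp add: sum_divide_distrib[symmetric] mult.commute
      sum.swap[of "\<lambda>u v. f u v" "words l n" "words k m"])

lemma avg_le: "k > 0 \<Longrightarrow> (\<And>w. w \<in> words k n \<Longrightarrow> f w \<le> c) \<Longrightarrow> avg k n f \<le> c"
  using avg_mono[of k n f "\<lambda>_. c"] by simp

lemma avg_ge: "k > 0 \<Longrightarrow> (\<And>w. w \<in> words k n \<Longrightarrow> c \<le> f w) \<Longrightarrow> c \<le> avg k n f"
  using avg_mono[of k n "\<lambda>_. c" f] by simp

lemma avg_less:
  assumes "k > 0" "\<And>w. w \<in> words k n \<Longrightarrow> f w < c"
  shows "avg k n f < c"
proof -
  have "words k n \<noteq> {}" using assms(1) card_words[of k n] by force
  then have "sum f (words k n) < (\<Sum>w\<in>words k n. c)" by (intro sum_strict_mono) (use assms in auto)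
  then show ?thesis using assms(1) by (simp add: avg_def divide_less_eq mult.commute)
qed

lemma avg_witness: "k > 0 \<Longrightarrow> c \<le> avg k n f \<Longrightarrow> \<exists>w\<in>words k n. c \<le> f w"
  using avg_less[of k n f c] by force

abbreviation dens :: "nat \<Rightarrow> nat \<Rightarrow> (nat list \<Rightarrow> bool) \<Rightarrow> real" where
  "dens k n A \<equiv> avg k n (\<lambda>w. of_bool (A w))"

section \<open>Patterns, substitution and composition\<close>

datatype symb = Letter nat | Wild nat

primrec subst1 :: "nat list \<Rightarrow> symb \<Rightarrow> nat" where
  "subst1 x (Letter a) = a"
| "subst1 x (Wild j) = x ! j"

definition subst :: "symb list \<Rightarrow> nat list \<Rightarrow> nat list" where
  "subst P x = map (subst1 x) P"

primrec symb_ok :: "nat \<Rightarrow> nat \<Rightarrow> symb \<Rightarrow> bool" where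
  "symb_ok k d (Letter a) \<longleftrightarrow> a < k"
| "symb_ok k d (Wild j) \<longleftrightarrow> j < d"

text \<open>A \<open>d\<close>-dimensional combinatorial subspace of the words of length \<open>n\<close> is encoded by its
  pattern; since a pattern over \<open>k\<close> letters is also one over \<open>k + 1\<close> letters, subspaces extend
  to larger alphabets for free.\<close>

definition pattern :: "nat \<Rightarrow> nat \<Rightarrow> nat \<Rightarrow> symb list \<Rightarrow> bool" where
  "pattern k d n P \<longleftrightarrow> length P = n \<and> (\<forall>e\<in>set P. symb_ok k d e) \<and> (\<forall>j<d. Wild j \<in> set P)"

lemma length_subst [simp]: "length (subst P x) = length P"
  by (simp add: subst_def)

lemma subst_append [simp]: "subst (P @ Q) x = subst P x @ subst Q x"
  by (simp add: subst_def)

lemma subst_Letter [simp]: "subst (map Letter u) x = u"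
  by (simp add: subst_def comp_def)

lemma pattern_length: "pattern k d n P \<Longrightarrow> length P = n"
  by (simp add: pattern_def)

lemma symb_ok_mono: "symb_ok k d e \<Longrightarrow> k \<le> k' \<Longrightarrow> symb_ok k' d e"
  by (cases e) auto

lemma pattern_mono: "pattern k d n P \<Longrightarrow> k \<le> k' \<Longrightarrow> pattern k' d n P"
  using symb_ok_mono by (auto simp: pattern_def)

lemma subst1_less: "symb_ok k d e \<Longrightarrow> x \<in> words k d \<Longrightarrow> subst1 x e < k"
  by (cases e) (auto simp: words_nth)

lemma subst_in_words: "pattern k d n P \<Longrightarrow> x \<in> words k d \<Longrightarrow> subst P x \<in> words k n"
  by (auto simp: pattern_def words_def[of k n] subst_def subst1_less)

lemma subst_in_words_mono:
  "pattern k d n P \<Longrightarrow> k \<le> k' \<Longrightarrow> x \<in> words k' d \<Longrightarrow> subst P x \<in> words k' n"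
  using subst_in_words pattern_mono by blast

text \<open>Every wildcard occurs in \<open>P\<close>, so each letter of \<open>x\<close> can be
  read off from \<open>subst P x\<close>.\<close>

lemma inj_on_subst:
  assumes "pattern k d n P"
  shows "inj_on (subst P) (words k' d)"
proof (rule inj_onI)
  fix x y assume xy: "x \<in> words k' d" "y \<in> words k' d" "subst P x = subst P y"
  have "x ! j = y ! j" if "j < d" for j
  proof -
    have "Wild j \<in> set P" using assms that by (auto simp: pattern_def)
    moreover have "\<forall>e\<in>set P. subst1 x e = subst1 y e" using xy(3) by (simp add: subst_def)
    ultimately show ?thesis by fastforce
  qed
  then show "x = y" using xy(1,2) by (simp add: words_length list_eq_iff_nth_eq)
qed

text \<open>Composition of patterns expresses that a subspace of a subspace is again a
  subspace.\<close>

primrec comp1 :: "symb list \<Rightarrow> symb \<Rightarrow> symb" where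
  "comp1 R (Letter a) = Letter a"
| "comp1 R (Wild j) = R ! j"

definition pcomp :: "symb list \<Rightarrow> symb list \<Rightarrow> symb list" where
  "pcomp P R = map (comp1 R) P"

lemma subst_pcomp:
  assumes "pattern k m n P" "length R = m"
  shows "subst (pcomp P R) x = subst P (subst R x)"
proof -
  have "subst1 x (comp1 R e) = subst1 (subst R x) e" if "e \<in> set P" for e
    using assms that by (cases e) (auto simp: pattern_def subst_def)
  then show ?thesis by (simp add: subst_def pcomp_def)
qed

lemma pattern_pcomp:
  assumes "pattern k m n P" "pattern k d m R"
  shows "pattern k d n (pcomp P R)"
  unfolding pattern_def
proof (intro conjI ballI allI impI)
  show "length (pcomp P R) = n" using assms by (simp add: pattern_def pcomp_def)
next
  fix e assume "e \<in> set (pcomp P R)"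
  then obtain f where f: "f \<in> set P" "e = comp1 R f" by (auto simp: pcomp_def)
  have "symb_ok k m f" using f assms by (auto simp: pattern_def)
  then show "symb_ok k d e" using f assms(2) by (cases f) (auto simp: pattern_def)
next
  fix j assume "j < d"
  then obtain i where i: "i < m" "R ! i = Wild j"
    using assms(2) by (auto simp: pattern_def in_set_conv_nth)
  then have "Wild i \<in> set P" using assms(1) by (auto simp: pattern_def)
  then show "Wild j \<in> set (pcomp P R)" using i by (force simp: pcomp_def)
qed

lemma pattern_Letter: "w \<in> words k n \<Longrightarrow> pattern k 0 n (map Letter w)"
  by (auto simp: pattern_def words_def)

lemma pattern_embed:
  assumes "pattern k d n P" "u \<in> words k l" "v \<in> words k r"
  shows "pattern k d (l + n + r) (map Letter u @ P @ map Letter v)"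
  using assms by (auto simp: pattern_def words_def)

lemma pattern_prefix:
  assumes "pattern k d n P" "u \<in> words k l"
  shows "pattern k d (l + n) (map Letter u @ P)"
  using pattern_embed[OF assms, of "[]" 0] by simp

lemma pattern_suffix:
  assumes "pattern k d n P" "v \<in> words k r"
  shows "pattern k d (n + r) (P @ map Letter v)"
  using pattern_embed[OF assms(1) _ assms(2), of "[]" 0] by simp

definition pvars :: "nat \<Rightarrow> symb list" where
  "pvars d = map Wild [0..<d]"

lemma pattern_pvars: "pattern k d d (pvars d)"
  by (auto simp: pattern_def pvars_def)

lemma subst_pvars: "length x = d \<Longrightarrow> subst (pvars d) x = x"
  by (auto simp: subst_def pvars_def comp_def map_nth)

text \<open>Renumbering that frees the wildcard 0 for a block placed in front;
  \<open>pattern_Cons\<close> uses it to multiply a line with a subspace.\<close>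

primrec shift1 :: "symb \<Rightarrow> symb" where
  "shift1 (Letter a) = Letter a"
| "shift1 (Wild j) = Wild (Suc j)"

lemma subst_shift: "subst (map shift1 P) (a # x) = subst P x"
proof -
  have "subst1 (a # x) (shift1 e) = subst1 x e" for e by (cases e) auto
  then show ?thesis by (simp add: subst_def)
qed

lemma subst_single:
  assumes "pattern k 1 n P"
  shows "subst P (a # x) = subst P [a]"
proof -
  have "subst1 (a # x) e = subst1 [a] e" if "e \<in> set P" for e
  proof -
    have "symb_ok k 1 e" using assms that by (auto simp: pattern_def)
    then show ?thesis by (cases e) auto
  qed
  then show ?thesis by (simp add: subst_def)
qed

lemma pattern_Cons:
  assumes "pattern k 1 m P" "pattern k d n Q"
  shows "pattern k (Suc d) (m + n) (P @ map shift1 Q)"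
  unfolding pattern_def
proof (intro conjI ballI allI impI)
  fix e assume "e \<in> set (P @ map shift1 Q)"
  then consider "e \<in> set P" | f where "f \<in> set Q" "e = shift1 f" by auto
  then show "symb_ok k (Suc d) e"
  proof cases
    case 1
    then have "symb_ok k 1 e" using assms by (auto simp: pattern_def)
    then show ?thesis by (cases e) auto
  next
    case 2
    then have "symb_ok k d f" using assms by (auto simp: pattern_def)
    then show ?thesis using 2 by (cases f) auto
  qed
next
  fix j assume "j < Suc d"
  then show "Wild j \<in> set (P @ map shift1 Q)"
  proof (cases j)
    case 0
    then show ?thesis using assms by (auto simp: pattern_def)
  next
    case (Suc i)
    then have "Wild i \<in> set Q" using assms \<open>j < Suc d\<close> by (auto simp: pattern_def)
    then show ?thesis using Suc by force
  qed
qed (use assms in \<open>auto simp: pattern_def\<close>)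

lemma finite_patterns: "finite {P. pattern k d n P}"
proof (rule finite_subset)
  have "symb_ok k d e \<Longrightarrow> e \<in> Letter ` {..<k} \<union> Wild ` {..<d}" for e
    by (cases e) auto
  then show "{P. pattern k d n P} \<subseteq>
      {P. set P \<subseteq> Letter ` {..<k} \<union> Wild ` {..<d} \<and> length P = n}"
    by (auto simp: pattern_def)
  show "finite {P. set P \<subseteq> Letter ` {..<k} \<union> Wild ` {..<d} \<and> length P = n}"
    by (rule finite_lists_length_eq) auto
qed

section \<open>Multidimensional and colouring consequences of density Hales-Jewett\<close>

definition DHJ :: "nat \<Rightarrow> bool" where
  "DHJ k \<longleftrightarrow> (\<forall>\<delta>>0. \<exists>N. \<forall>n\<ge>N. \<forall>A. dens k n A \<ge> \<delta> \<longrightarrow>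
     (\<exists>P. pattern k 1 n P \<and> (\<forall>a<k. A (subst P [a]))))"

lemma dens_le_1: "k > 0 \<Longrightarrow> dens k n A \<le> 1"
  by (rule avg_le) auto

text \<open>By Fubini the words \<open>y\<close> whose fibre has density at least
  \<open>\<delta> / 2\<close> themselves have density at least \<open>\<delta> / 2\<close>. Each
  such fibre contains a line, and there are only finitely many lines, so one line serves a positive
  proportion of the \<open>y\<close>. The bound \<open>\<theta>\<close> depends on \<open>n\<close>
  but not on \<open>l\<close>, \<open>J\<close> and \<open>A\<close>.\<close>

lemma DHJ_pigeonhole:
  assumes "DHJ k" "k > 0" "\<delta> > 0"
  shows "\<exists>N. \<forall>n\<ge>N. \<exists>\<theta>>0. \<forall>l J A. l > 0 \<longrightarrow> avg k n (\<lambda>t. dens l J (A t)) \<ge> \<delta> \<longrightarrow>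
    (\<exists>P. pattern k 1 n P \<and> dens l J (\<lambda>y. \<forall>a<k. A (subst P [a]) y) \<ge> \<theta>)"
proof -
  obtain N where N: "\<And>n A. n \<ge> N \<Longrightarrow> dens k n A \<ge> \<delta> / 2 \<Longrightarrow>
      \<exists>P. pattern k 1 n P \<and> (\<forall>a<k. A (subst P [a]))"
    using assms unfolding DHJ_def by (meson half_gt_zero)
  show ?thesis
  proof (intro exI[of _ N] allI impI)
    fix n assume n: "N \<le> n"
    define C where "C = {P. pattern k 1 n P}"
    \<comment> \<open>The summand 1 makes the total over all lines strictly smaller than
      \<open>\<delta> / 2\<close> if every line serves less than \<open>\<theta>\<close>.\<close>
    define \<theta> where "\<theta> = \<delta> / 2 / (real (card C) + 1)"
    have \<theta>: "\<theta> > 0" using assms(3) by (simp add: \<theta>_def)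
    show "\<exists>\<theta>>0. \<forall>l J A. l > 0 \<longrightarrow> avg k n (\<lambda>t. dens l J (A t)) \<ge> \<delta> \<longrightarrow>
      (\<exists>P. pattern k 1 n P \<and> dens l J (\<lambda>y. \<forall>a<k. A (subst P [a]) y) \<ge> \<theta>)"
    proof (intro exI[of _ \<theta>] conjI allI impI \<theta>)
      fix l J and A :: "nat list \<Rightarrow> nat list \<Rightarrow> bool"
      assume l: "0 < l" and A: "avg k n (\<lambda>t. dens l J (A t)) \<ge> \<delta>"
      define G where "G y \<longleftrightarrow> dens k n (\<lambda>t. A t y) \<ge> \<delta> / 2" for y
      define H where "H P y \<longleftrightarrow> (\<forall>a<k. A (subst P [a]) y)" for P y
      have "\<delta> \<le> avg l J (\<lambda>y. dens k n (\<lambda>t. A t y))"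
        using A by (simp add: avg_swap[of k])
      also have "\<dots> \<le> avg l J (\<lambda>y. of_bool (G y) + \<delta> / 2)"
        using dens_le_1[OF assms(2)] assms(3)
        by (intro avg_mono) (auto simp: G_def add_increasing2)
      also have "\<dots> = dens l J G + \<delta> / 2"
        using l by (simp add: avg_add)
      also have "dens l J G \<le> avg l J (\<lambda>y. \<Sum>P\<in>C. of_bool (H P y))"
      proof (rule avg_mono)
        fix y
        show "of_bool (G y) \<le> (\<Sum>P\<in>C. of_bool (H P y) :: real)"
        proof (cases "G y")
          case True
          then obtain P where P: "P \<in> C" "H P y"
            using N[OF n, of "\<lambda>t. A t y"] by (auto simp: G_def H_def C_def)
          have "of_bool (H P y) \<le> (\<Sum>P\<in>C. of_bool (H P y) :: real)"
            using P(1) finite_patterns by (intro member_le_sum) (auto simp: C_def)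
          then show ?thesis using True P(2) by simp
        qed (simp add: sum_nonneg)
      qed
      also have "\<dots> = (\<Sum>P\<in>C. dens l J (H P))" by (rule avg_sum)
      finally have *: "\<delta> / 2 \<le> (\<Sum>P\<in>C. dens l J (H P))" by simp
      have "\<exists>P\<in>C. dens l J (H P) \<ge> \<theta>"
      proof (rule ccontr)
        assume "\<not> (\<exists>P\<in>C. dens l J (H P) \<ge> \<theta>)"
        then have "(\<Sum>P\<in>C. dens l J (H P)) \<le> of_nat (card C) * \<theta>"
          by (intro sum_bounded_above) force
        moreover have "of_nat (card C) * \<theta> < \<delta> / 2"
          using assms(3) by (simp add: \<theta>_def field_simps)
        ultimately show False using * by linarith
      qed
      then show "\<exists>P. pattern k 1 n P \<and> dens l J (\<lambda>y. \<forall>a<k. A (subst P [a]) y) \<ge> \<theta>"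
        by (auto simp: C_def H_def)
    qed
  qed
qed

text \<open>One dimension at a time: the pigeonhole lemma finds a line in a first block that works
  for a dense set of continuations, and the induction hypothesis finds a subspace among these
  continuations.\<close>

lemma DHJ_multidim:
  assumes "DHJ k" "k > 0" "\<delta> > 0"
  shows "\<exists>N. \<forall>n\<ge>N. \<forall>A. dens k n A \<ge> \<delta> \<longrightarrow>
    (\<exists>P. pattern k d n P \<and> (\<forall>x\<in>words k d. A (subst P x)))"
  using assms(3)
proof (induction d arbitrary: \<delta>)
  case 0
  show ?case
  proof (intro exI[of _ 0] allI impI)
    fix n A assume "\<delta> \<le> dens k n A"
    then obtain w where w: "w \<in> words k n" "\<delta> \<le> of_bool (A w)"
      using avg_witness[OF assms(2)] by blast
    then show "\<exists>P. pattern k 0 n P \<and> (\<forall>x\<in>words k 0. A (subst P x))"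
      using 0 by (intro exI[of _ "map Letter w"]) (cases "A w"; simp add: pattern_Letter)
  qed
next
  case (Suc d)
  obtain n1 \<theta> where \<theta>: "\<theta> > 0" and n1: "\<And>l J A. l > 0 \<Longrightarrow> avg k n1 (\<lambda>t. dens l J (A t)) \<ge> \<delta> \<Longrightarrow>
      \<exists>P. pattern k 1 n1 P \<and> dens l J (\<lambda>y. \<forall>a<k. A (subst P [a]) y) \<ge> \<theta>"
    using DHJ_pigeonhole[OF assms(1,2) Suc.prems] by (meson order_refl)
  obtain N2 where N2: "\<And>n A. n \<ge> N2 \<Longrightarrow> dens k n A \<ge> \<theta> \<Longrightarrow>
      \<exists>P. pattern k d n P \<and> (\<forall>x\<in>words k d. A (subst P x))"
    using Suc.IH[OF \<theta>] by blast
  show ?case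
  proof (intro exI[of _ "n1 + N2"] allI impI)
    fix n A assume n: "n1 + N2 \<le> n" and A: "\<delta> \<le> dens k n A"
    \<comment> \<open>\<open>\<theta>\<close>, and with it \<open>N2\<close>, depends on the length
      of the first block. That length therefore stays \<open>n1\<close>, and the second block takes
      up the rest.\<close>
    define n2 where "n2 = n - n1"
    have n2: "n = n1 + n2" "n2 \<ge> N2" using n by (auto simp: n2_def)
    have "avg k n1 (\<lambda>t. dens k n2 (\<lambda>y. A (t @ y))) \<ge> \<delta>"
      using A by (simp add: n2 avg_append)
    then obtain P where P: "pattern k 1 n1 P" "dens k n2 (\<lambda>y. \<forall>a<k. A (subst P [a] @ y)) \<ge> \<theta>"
      using n1[OF assms(2), of n2 "\<lambda>t y. A (t @ y)"] by blast
    obtain Q where Q: "pattern k d n2 Q"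
      "\<And>x. x \<in> words k d \<Longrightarrow> \<forall>a<k. A (subst P [a] @ subst Q x)"
      using N2[OF n2(2) P(2)] by blast
    have "A (subst (P @ map shift1 Q) x)" if "x \<in> words k (Suc d)" for x
      using that
    proof (rule words_SucE)
      fix a u assume "x = a # u" "a < k" "u \<in> words k d"
      then show ?thesis using Q(2) by (simp add: subst_shift subst_single[OF P(1), of a u])
    qed
    moreover have "pattern k (Suc d) n (P @ map shift1 Q)"
      unfolding n2 by (rule pattern_Cons[OF P(1) Q(1)])
    ultimately show "\<exists>P. pattern k (Suc d) n P \<and> (\<forall>x\<in>words k (Suc d). A (subst P x))"
      by blast
  qed
qed

text \<open>Some colour class has density at least \<open>1 / (r + 1)\<close>. Counting the colours
  through the image of \<open>f\<close> admits colour types that are infinite.\<close>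

lemma HJ_coloring:
  fixes d k r :: nat
  assumes "DHJ k" "k > 0"
  shows "\<exists>N. \<forall>n\<ge>N. \<forall>f :: nat list \<Rightarrow> 'c. card (f ` words k n) \<le> r \<longrightarrow>
    (\<exists>P. pattern k d n P \<and> (\<forall>x\<in>words k d. \<forall>y\<in>words k d. f (subst P x) = f (subst P y)))"
proof -
  define \<delta> where "\<delta> = 1 / (real r + 1)"
  have \<delta>: "\<delta> > 0" by (simp add: \<delta>_def)
  obtain N where N: "\<And>n A. n \<ge> N \<Longrightarrow> dens k n A \<ge> \<delta> \<Longrightarrow>
      \<exists>P. pattern k d n P \<and> (\<forall>x\<in>words k d. A (subst P x))"
    using DHJ_multidim[OF assms \<delta>] by blast
  show ?thesis
  proof (intro exI[of _ N] allI impI)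
    fix n and f :: "nat list \<Rightarrow> 'c"
    assume n: "N \<le> n" and r: "card (f ` words k n) \<le> r"
    have "\<exists>c\<in>f ` words k n. dens k n (\<lambda>w. f w = c) \<ge> \<delta>"
    proof (rule ccontr)
      assume *: "\<not> ?thesis"
      have "(1::real) = dens k n (\<lambda>_. True)" using assms(2) by simp
      also have "\<dots> = avg k n (\<lambda>w. \<Sum>c\<in>f ` words k n. of_bool (f w = c))"
        by (intro avg_cong) (simp add: of_bool_def)
      also have "\<dots> = (\<Sum>c\<in>f ` words k n. dens k n (\<lambda>w. f w = c))" by (rule avg_sum)
      also have "\<dots> \<le> of_nat (card (f ` words k n)) * \<delta>"
        using * by (intro sum_bounded_above) force
      also have "\<dots> \<le> real r * \<delta>" using r \<delta> by simp
      also have "\<dots> < 1" by (simp add: \<delta>_def)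
      finally show False by simp
    qed
    then obtain c where "dens k n (\<lambda>w. f w = c) \<ge> \<delta>" by blast
    from N[OF n this] obtain P where "pattern k d n P" "\<forall>x\<in>words k d. f (subst P x) = c"
      by blast
    then show "\<exists>P. pattern k d n P \<and>
        (\<forall>x\<in>words k d. \<forall>y\<in>words k d. f (subst P x) = f (subst P y))"
      by auto
  qed
qed

section \<open>Replacing the last letter of the larger alphabet\<close>

definition rep :: "nat \<Rightarrow> nat \<Rightarrow> nat list \<Rightarrow> nat list" where
  "rep k i x = map (\<lambda>a. if a = k then i else a) x"

lemma rep_append [simp]: "rep k i (u @ v) = rep k i u @ rep k i v"
  by (simp add: rep_def)

lemma length_rep [simp]: "length (rep k i x) = length x"
  by (simp add: rep_def)

lemma rep_idem [simp]: "rep k i (rep k i x) = rep k i x"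
  by (simp add: rep_def comp_def)

lemma rep_in_words: "i < k \<Longrightarrow> x \<in> words (Suc k) n \<Longrightarrow> rep k i x \<in> words k n"
  by (auto simp: rep_def words_def subset_iff less_Suc_eq)

text \<open>A pattern over \<open>k\<close> letters does not contain the letter \<open>k\<close>
  itself, so that letter enters \<open>subst P x\<close> only through \<open>x\<close>.\<close>

lemma rep_subst:
  assumes "pattern k d n P" "length x = d"
  shows "rep k i (subst P x) = subst P (rep k i x)"
proof -
  have "(if subst1 x e = k then i else subst1 x e) = subst1 (rep k i x) e" if "e \<in> set P" for e
  proof -
    have "symb_ok k d e" using assms that by (auto simp: pattern_def)
    then show ?thesis using assms(2) by (cases e) (auto simp: rep_def)
  qed
  then show ?thesis by (simp add: rep_def subst_def)
qed

text \<open>A word over \<open>Suc k\<close> letters doubles as a pattern over \<open>k\<close>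
  letters with \<open>k\<close> as its wildcard; this records the wildcard positions.\<close>

abbreviation wilds :: "nat \<Rightarrow> nat list \<Rightarrow> bool list" where
  "wilds k x \<equiv> map (\<lambda>a. a = k) x"

section \<open>Subspaces all of whose lines are good\<close>

text \<open>The coordinates are treated one after the other. The first block is chosen so that
  exchanging letters below \<open>k\<close> in the first coordinate changes no colour, whatever
  surrounds the block. The prefix \<open>y\<close> is there for the induction, in which the first
  coordinate becomes part of the prefix for the later ones.\<close>

lemma color_depends_on_wilds:
  assumes "DHJ k" "k > 0"
  shows "\<exists>n. \<forall>A :: nat list \<Rightarrow> bool. \<exists>Q. pattern k m n Q \<and> (\<forall>y\<in>words (Suc k) l.
    \<forall>x\<in>words (Suc k) m. \<forall>x'\<in>words (Suc k) m. wilds k x = wilds k x' \<longrightarrow>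
      A (y @ subst Q x) = A (y @ subst Q x'))"
proof (induction m arbitrary: l)
  case 0
  show ?case
    by (intro exI[of _ 0] allI exI[of _ "[]"]) (auto simp: pattern_def)
next
  case (Suc m)
  let ?K = "Suc k"
  obtain n' where n': "\<forall>A :: nat list \<Rightarrow> bool. \<exists>Q. pattern k m n' Q \<and> (\<forall>y\<in>words ?K (Suc l).
    \<forall>x\<in>words ?K m. \<forall>x'\<in>words ?K m. wilds k x = wilds k x' \<longrightarrow>
      A (y @ subst Q x) = A (y @ subst Q x'))"
    using Suc.IH[of "Suc l"] ..
  define S where "S = words ?K l \<times> words ?K n'"
  obtain n1 where n1: "\<And>f :: nat list \<Rightarrow> (nat list \<times> nat list) set.
    card (f ` words k n1) \<le> card (Pow S) \<Longrightarrow> \<exists>P. pattern k 1 n1 P \<and>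
      (\<forall>x\<in>words k 1. \<forall>y\<in>words k 1. f (subst P x) = f (subst P y))"
    using HJ_coloring[OF assms, of "card (Pow S)" 1] by (meson order_refl)
  show ?case
  proof (intro exI[of _ "n1 + n'"] allI)
    fix A :: "nat list \<Rightarrow> bool"
    \<comment> \<open>The colour of \<open>w\<close> is the set of all contexts that put it into
      \<open>A\<close>, so a monochromatic line works in all contexts at once.\<close>
    define f where "f w = {(y, z) \<in> S. A (y @ w @ z)}" for w
    have "card (f ` words k n1) \<le> card (Pow S)"
      by (intro card_mono) (auto simp: f_def S_def)
    then obtain P where P: "pattern k 1 n1 P"
      "\<And>a b. a < k \<Longrightarrow> b < k \<Longrightarrow> f (subst P [a]) = f (subst P [b])"
      using n1[of f] by force
    \<comment> \<open>In the colouring given to the induction hypothesis, the letter at position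
      \<open>l\<close> stands for the point of the line \<open>P\<close> with that
      parameter.\<close>
    obtain Q where Q: "pattern k m n' Q" "\<And>s x x'. s \<in> words ?K (Suc l) \<Longrightarrow>
        x \<in> words ?K m \<Longrightarrow> x' \<in> words ?K m \<Longrightarrow> wilds k x = wilds k x' \<Longrightarrow>
        A (take l (s @ subst Q x) @ subst P [(s @ subst Q x) ! l] @ drop (Suc l) (s @ subst Q x)) =
        A (take l (s @ subst Q x') @ subst P [(s @ subst Q x') ! l] @ drop (Suc l) (s @ subst Q x'))"
      using n'[THEN spec, of "\<lambda>s. A (take l s @ subst P [s ! l] @ drop (Suc l) s)"] by metis
    show "\<exists>Q. pattern k (Suc m) (n1 + n') Q \<and> (\<forall>y\<in>words ?K l.
      \<forall>x\<in>words ?K (Suc m). \<forall>x'\<in>words ?K (Suc m). wilds k x = wilds k x' \<longrightarrow>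
      A (y @ subst Q x) = A (y @ subst Q x'))"
    proof (intro exI[of _ "P @ map shift1 Q"] conjI ballI impI)
      show "pattern k (Suc m) (n1 + n') (P @ map shift1 Q)" by (rule pattern_Cons[OF P(1) Q(1)])
    next
      fix y x x'
      assume y: "y \<in> words ?K l" and x: "x \<in> words ?K (Suc m)" "x' \<in> words ?K (Suc m)"
        and eq: "wilds k x = wilds k x'"
      obtain a u where u: "x = a # u" "a < ?K" "u \<in> words ?K m" using x(1) by (rule words_SucE)
      obtain b v where v: "x' = b # v" "b < ?K" "v \<in> words ?K m" using x(2) by (rule words_SucE)
      have "A (y @ subst P [a] @ subst Q u) = A (y @ subst P [a] @ subst Q v)"
        using Q(2)[of "y @ [a]" u v] y u v eq by (simp add: words_length nth_append)
      also have "\<dots> = A (y @ subst P [b] @ subst Q v)"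
      proof (cases "a = b")
        case False
        then have "a < k" "b < k" using u v eq by auto
        then have "f (subst P [a]) = f (subst P [b])" using P(2) by blast
        moreover have "(y, subst Q v) \<in> S"
          using y v(3) subst_in_words_mono[OF Q(1)] by (auto simp: S_def)
        ultimately show ?thesis by (auto simp: f_def)
      qed simp
      finally show "A (y @ subst (P @ map shift1 Q) x) = A (y @ subst (P @ map shift1 Q) x')"
        by (simp add: u(1) v(1) subst_shift subst_single[OF P(1), of _ u] subst_single[OF P(1), of _ v])
    qed
  qed
qed

primrec top1 :: "nat \<Rightarrow> symb \<Rightarrow> symb" where
  "top1 m (Letter a) = (if a = 0 then Letter 0 else Wild m)"
| "top1 m (Wild j) = Wild j"

lemma pattern_zeros: "k > 0 \<Longrightarrow> pattern k 0 n (replicate n (Letter 0))"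
  by (auto simp: pattern_def)

lemma subst_snoc:
  assumes "pattern k d n P" "length x = d"
  shows "subst P (x @ [a]) = subst P x"
proof -
  have "subst1 (x @ [a]) e = subst1 x e" if "e \<in> set P" for e
  proof -
    have "symb_ok k d e" using assms that by (auto simp: pattern_def)
    then show ?thesis using assms(2) by (cases e) (auto simp: nth_append)
  qed
  then show ?thesis by (simp add: subst_def)
qed

text \<open>A finite version of Folkman's theorem on unions. All letters of \<open>P0\<close> other than \<open>0\<close> are
  turned into the new wildcard \<open>m\<close>, and so the colour of a word whose last letter is the
  wildcard does not depend on its other letters.\<close>

lemma good_or_bad_subspace:
  assumes "DHJ k" "k \<ge> 2"
  shows "\<exists>N. \<forall>n\<ge>N. \<forall>c. (\<forall>x\<in>words (Suc k) n. \<forall>x'\<in>words (Suc k) n.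
      wilds k x = wilds k x' \<longrightarrow> c x = c x') \<longrightarrow>
    (\<exists>P. pattern k p n P \<and> (\<forall>x\<in>words (Suc k) p. k \<in> set x \<longrightarrow> c (subst P x))) \<or>
    (\<exists>P. pattern k q n P \<and> (\<forall>x\<in>words (Suc k) q. k \<in> set x \<longrightarrow> \<not> c (subst P x)))"
proof (induction "p + q" arbitrary: p q)
  case 0
  then show ?case using pattern_zeros[of k] assms(2) by force
next
  case (Suc s)
  let ?K = "Suc k"
  show ?case
  proof (cases "p = 0 \<or> q = 0")
    case True
    then show ?thesis using pattern_zeros[of k] assms(2) by force
  next
    case False
    then obtain p' q' where pq: "p = Suc p'" "q = Suc q'" by (meson not0_implies_Suc)
    have s: "s = p' + q" "s = p + q'" using Suc.hyps(2) pq by auto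
    define W where "W n c \<longleftrightarrow> (\<forall>x\<in>words ?K n. \<forall>x'\<in>words ?K n.
      wilds k x = wilds k x' \<longrightarrow> c x = c x')" for n and c :: "nat list \<Rightarrow> bool"
    define G where "G n d c \<longleftrightarrow> (\<exists>P. pattern k d n P \<and>
      (\<forall>x\<in>words ?K d. k \<in> set x \<longrightarrow> c (subst P x)))" for n d and c :: "nat list \<Rightarrow> bool"
    obtain N1 where N1: "\<forall>n\<ge>N1. \<forall>c. W n c \<longrightarrow> G n p' c \<or> G n q (\<lambda>x. \<not> c x)"
      using Suc.hyps(1)[OF s(1)] unfolding W_def G_def ..
    obtain N2 where N2: "\<forall>n\<ge>N2. \<forall>c. W n c \<longrightarrow> G n p c \<or> G n q' (\<lambda>x. \<not> c x)"
      using Suc.hyps(1)[OF s(2)] unfolding W_def G_def ..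
    \<comment> \<open>As in Ramsey's theorem, dimension \<open>m\<close> is large enough for both
      induction hypotheses, with \<open>p\<close> or with \<open>q\<close> lowered by one.\<close>
    define m where "m = max N1 N2"
    obtain N0 where N0: "\<And>n (f :: nat list \<Rightarrow> bool). n \<ge> N0 \<Longrightarrow> card (f ` words k n) \<le> 2 \<Longrightarrow>
      \<exists>P. pattern k m n P \<and> (\<forall>x\<in>words k m. \<forall>y\<in>words k m. f (subst P x) = f (subst P y))"
      using HJ_coloring[OF assms(1), of 2 m] assms(2) by fastforce
    have main: "G n p c \<or> G n q (\<lambda>x. \<not> c x)" if n: "n \<ge> Suc N0" and c: "W n c" for n c
    proof -
      define n0 where "n0 = n - 1"
      have n0: "n = Suc n0" "n0 \<ge> N0" using n by (auto simp: n0_def)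
      \<comment> \<open>\<open>?g\<close> turns a word over \<open>k\<close> letters into the set of
        its nonzero positions, marked by \<open>k\<close>. The extra final \<open>k\<close> keeps
        this set nonempty.\<close>
      let ?g = "\<lambda>a. if a = 0 then 0 else k"
      have cW: "c x = c x'" if "x \<in> words ?K n" "x' \<in> words ?K n" "wilds k x = wilds k x'" for x x'
        using c that unfolding W_def by blast
      obtain P0 where P0: "pattern k m n0 P0" "\<And>x y. x \<in> words k m \<Longrightarrow> y \<in> words k m \<Longrightarrow>
          c (map ?g (subst P0 x) @ [k]) = c (map ?g (subst P0 y) @ [k])"
      proof -
        have "card ((\<lambda>w. c (map ?g w @ [k])) ` words k n0) \<le> card (UNIV :: bool set)"
          by (rule card_mono) auto
        then show ?thesis using N0[of n0 "\<lambda>w. c (map ?g w @ [k])"] n0(2) that by auto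
      qed
      \<comment> \<open>The final \<open>Wild m\<close> ensures that the new wildcard occurs even if
        0 is the only letter in \<open>P0\<close>.\<close>
      define P1 where "P1 = map (top1 m) P0 @ [Wild m]"
      have okP0: "symb_ok k m e" if "e \<in> set P0" for e using P0(1) that by (auto simp: pattern_def)
      have ok1: "symb_ok k (Suc m) (top1 m e)" if "e \<in> set P0" for e
        using okP0[OF that] assms(2) by (cases e) auto
      have P1: "pattern k (Suc m) n P1"
        unfolding pattern_def
      proof (intro conjI allI impI)
        show "length P1 = n" using P0(1) n0 by (simp add: P1_def pattern_def)
        show "\<forall>e\<in>set P1. symb_ok k (Suc m) e" using ok1 by (auto simp: P1_def)
        fix j assume "j < Suc m"
        show "Wild j \<in> set P1"
        proof (cases "j = m")
          case False
          then have "Wild j \<in> set P0" using P0(1) \<open>j < Suc m\<close> by (auto simp: pattern_def)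
          then show ?thesis by (force simp: P1_def)
        qed (simp add: P1_def)
      qed
      have inK: "subst P1 x \<in> words ?K n" if "x \<in> words ?K (Suc m)" for x
        using subst_in_words_mono[OF P1 _ that] by simp
      \<comment> \<open>When the new wildcard is \<open>k\<close>, the wildcard positions are those
        of a word from the monochromatic subspace \<open>P0\<close>, with 1 standing for
        \<open>k\<close> and 0 for every other letter. This takes two letters below
        \<open>k\<close>.\<close>
      have top: "c (subst P1 (x @ [k])) = c (map ?g (subst P0 (map (\<lambda>a. if a = k then 1 else 0) x)) @ [k])"
        if x: "x \<in> words ?K m" for x
      proof (rule cW)
        let ?w = "map (\<lambda>a. if a = k then 1 else 0) x"
        have w: "?w \<in> words k m" using x assms(2) by (auto simp: words_def)
        show "subst P1 (x @ [k]) \<in> words ?K n" using x by (intro inK) simp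
        have "map ?g (subst P0 ?w) \<in> words ?K n0"
          using subst_in_words[OF P0(1) w] by (auto simp: words_def)
        then show "map ?g (subst P0 ?w) @ [k] \<in> words ?K n" using n0 by simp
        have "(subst1 (x @ [k]) (top1 m e) = k) \<longleftrightarrow> (?g (subst1 ?w e) = k)" if "e \<in> set P0" for e
          using okP0[OF that] x assms(2)
          by (cases e) (auto simp: nth_append words_length)
        then show "wilds k (subst P1 (x @ [k])) = wilds k (map ?g (subst P0 ?w) @ [k])"
          using x by (auto simp: P1_def subst_def nth_append words_length)
      qed
      define b where "b \<longleftrightarrow> c (map ?g (subst P0 (replicate m 0)) @ [k])"
      have topb: "c (subst P1 (x @ [k])) = b" if x: "x \<in> words ?K m" for x
        unfolding top[OF x] b_def by (rule P0(2)) (use x assms(2) in \<open>auto simp: words_def\<close>)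
      \<comment> \<open>The induction hypotheses are applied to this colouring of the words whose
        last coordinate is 0; by \<open>low\<close> every other letter below \<open>k\<close> gives
        the same colour.\<close>
      define c' where "c' x = c (subst P1 (x @ [0]))" for x
      have low: "c (subst P1 (x @ [a])) = c' x" if x: "x \<in> words ?K m" "a < k" for x a
        unfolding c'_def
      proof (rule cW)
        show "subst P1 (x @ [a]) \<in> words ?K n" using that by (intro inK) auto
        show "subst P1 (x @ [0]) \<in> words ?K n" using that by (intro inK) auto
        have "(subst1 (x @ [a]) e = k) \<longleftrightarrow> (subst1 (x @ [0]) e = k)" if "e \<in> set P1" for e
        proof -
          have "symb_ok k (Suc m) e" using P1 that by (auto simp: pattern_def)
          then show ?thesis using x assms(2) by (cases e) (auto simp: nth_append words_length)
        qed
        then show "wilds k (subst P1 (x @ [a])) = wilds k (subst P1 (x @ [0]))"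
          by (simp add: subst_def)
      qed
      have W': "W m c'"
        unfolding W_def
      proof (intro ballI impI)
        fix x x' assume x: "x \<in> words ?K m" "x' \<in> words ?K m" "wilds k x = wilds k x'"
        have nth: "x ! j = k \<longleftrightarrow> x' ! j = k" if "j < m" for j
        proof -
          have "wilds k x ! j = wilds k x' ! j" using x(3) by simp
          then show ?thesis using that x(1,2) by (simp add: words_length)
        qed
        show "c' x = c' x'"
          unfolding c'_def
        proof (rule cW)
          show "subst P1 (x @ [0]) \<in> words ?K n" "subst P1 (x' @ [0]) \<in> words ?K n"
            using x assms(2) by (auto intro!: inK)
          have "(subst1 (x @ [0]) e = k) \<longleftrightarrow> (subst1 (x' @ [0]) e = k)" if "e \<in> set P1" for e
          proof -
            have "symb_ok k (Suc m) e" using P1 that by (auto simp: pattern_def)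
            then show ?thesis using x nth by (cases e) (auto simp: nth_append words_length)
          qed
          then show "wilds k (subst P1 (x @ [0])) = wilds k (subst P1 (x' @ [0]))"
            by (simp add: subst_def)
        qed
      qed
      \<comment> \<open>If the colour \<open>b\<close> is the wanted one, the last coordinate can be
        kept as a wildcard, which gains a dimension.\<close>
      have up: "G n (Suc d) C" if G: "G m d C'" and C: "\<And>x. x \<in> words ?K m \<Longrightarrow> C (subst P1 (x @ [k]))"
          "\<And>x a. x \<in> words ?K m \<Longrightarrow> a < k \<Longrightarrow> C (subst P1 (x @ [a])) = C' x" for d C C'
      proof -
        obtain R where R: "pattern k d m R" "\<And>x. x \<in> words ?K d \<Longrightarrow> k \<in> set x \<Longrightarrow> C' (subst R x)"
          using G unfolding G_def by blast
        have "symb_ok k (Suc d) e" if "symb_ok k d e" for e using that by (cases e) auto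
        then have R': "pattern k (Suc d) (Suc m) (R @ [Wild d])"
          using R(1) by (auto simp: pattern_def less_Suc_eq)
        have "C (subst (pcomp P1 (R @ [Wild d])) x)" if x: "x \<in> words ?K (Suc d)" "k \<in> set x" for x
        proof -
          obtain a u where u: "x = u @ [a]" "a < ?K" "u \<in> words ?K d" using x(1) by (rule words_snocE)
          have Ru: "subst R u \<in> words ?K m" using subst_in_words_mono[OF R(1) _ u(3)] by simp
          have "subst (R @ [Wild d]) x = subst R u @ [a]"
            using subst_snoc[OF R(1), of u a] words_length[OF u(3)] u(1)
            by (simp add: subst_def[of "[Wild d]"] nth_append)
          then have eq: "subst (pcomp P1 (R @ [Wild d])) x = subst P1 (subst R u @ [a])"
            using subst_pcomp[OF P1, of "R @ [Wild d]"] R' by (simp add: pattern_def)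
          show ?thesis
          proof (cases "a = k")
            case True
            then show ?thesis using C(1)[OF Ru] eq by simp
          next
            case False
            then have "k \<in> set u" "a < k" using x u by auto
            then show ?thesis using C(2)[OF Ru] R(2)[OF u(3)] eq by simp
          qed
        qed
        then show ?thesis unfolding G_def using pattern_pcomp[OF P1 R'] by blast
      qed
      \<comment> \<open>For the other colour the last coordinate is fixed to 0 and the dimension is
        kept.\<close>
      have same: "G n d C" if G: "G m d C'" and C: "\<And>x. x \<in> words ?K m \<Longrightarrow> C (subst P1 (x @ [0])) = C' x"
        for d C C'
      proof -
        obtain R where R: "pattern k d m R" "\<And>x. x \<in> words ?K d \<Longrightarrow> k \<in> set x \<Longrightarrow> C' (subst R x)"
          using G unfolding G_def by blast
        have R': "pattern k d (Suc m) (R @ [Letter 0])"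
          using R(1) assms(2) by (auto simp: pattern_def)
        have "C (subst (pcomp P1 (R @ [Letter 0])) x)" if x: "x \<in> words ?K d" "k \<in> set x" for x
        proof -
          have Ru: "subst R x \<in> words ?K m" using subst_in_words_mono[OF R(1) _ x(1)] by simp
          have "subst (pcomp P1 (R @ [Letter 0])) x = subst P1 (subst R x @ [0])"
            using subst_pcomp[OF P1, of "R @ [Letter 0]"] R' by (simp add: pattern_def subst_def)
          then show ?thesis using C[OF Ru] R(2)[OF x] by simp
        qed
        then show ?thesis unfolding G_def using pattern_pcomp[OF P1 R'] by blast
      qed
      show ?thesis
      proof (cases b)
        case True
        have "G m p' c' \<or> G m q (\<lambda>x. \<not> c' x)" using N1[rule_format, of m c'] W' by (simp add: m_def)
        then show ?thesis
        proof
          assume "G m p' c'"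
          then have "G n (Suc p') c" by (rule up) (simp_all add: topb low True)
          then show ?thesis using pq by simp
        next
          assume "G m q (\<lambda>x. \<not> c' x)"
          then have "G n q (\<lambda>x. \<not> c x)" by (rule same) (simp add: c'_def)
          then show ?thesis ..
        qed
      next
        case False
        have "G m p c' \<or> G m q' (\<lambda>x. \<not> c' x)" using N2[rule_format, of m c'] W' by (simp add: m_def)
        then show ?thesis
        proof
          assume "G m p c'"
          then have "G n p c" by (rule same) (simp add: c'_def)
          then show ?thesis ..
        next
          assume "G m q' (\<lambda>x. \<not> c' x)"
          then have "G n (Suc q') (\<lambda>x. \<not> c x)" by (rule up) (simp_all add: topb low False)
          then show ?thesis using pq by simp
        qed
      qed
    qed
    have "\<forall>n\<ge>Suc N0. \<forall>c. W n c \<longrightarrow> G n p c \<or> G n q (\<lambda>x. \<not> c x)" using main by blast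
    then have "\<exists>N. \<forall>n\<ge>N. \<forall>c. W n c \<longrightarrow> G n p c \<or> G n q (\<lambda>x. \<not> c x)" by (rule exI)
    then show ?thesis by (simp only: W_def G_def)
  qed
qed

text \<open>Colour a word as good if the density in question is at least \<open>\<theta>\<close>,
  and pass to a subspace where the colour depends only on the positions of \<open>k\<close>. A bad
  subspace of dimension \<open>m0\<close> cannot exist, since the pigeonhole lemma finds in it a
  line that is a good word. Thus \<open>\<theta>\<close> depends on \<open>m0\<close> but not on
  \<open>m\<close>, which the density increment relies on.\<close>

lemma good_subspace:
  assumes "DHJ k" "k > 0" "\<delta> > 0"
  shows "\<exists>\<theta>>0. \<forall>m. \<exists>M. \<forall>l J A. l > 0 \<longrightarrow> (\<forall>t\<in>words k M. dens l J (A t) \<ge> \<delta>) \<longrightarrow>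
    (\<exists>Q. pattern k m M Q \<and> (\<forall>x\<in>words (Suc k) m. k \<in> set x \<longrightarrow>
       dens l J (\<lambda>y. \<forall>i<k. A (subst Q (rep k i x)) y) \<ge> \<theta>))"
\<comment> \<open>\<open>good_or_bad_subspace\<close> works with the letters 0 and 1. With a single
  letter only \<open>i = 0\<close> remains, and the hypothesis is already the conclusion.\<close>
proof (cases "k = 1")
  case True
  show ?thesis
  proof (intro exI[of _ \<delta>] conjI allI impI assms(3))
    fix m
    have "dens l J (\<lambda>y. \<forall>i<k. A (subst (pvars m) (rep k i x)) y) \<ge> \<delta>"
      if "\<forall>t\<in>words k m. dens l J (A t) \<ge> \<delta>" "x \<in> words (Suc k) m" for l J A x
      using that rep_in_words[of 0 k x m] True by (simp add: subst_pvars words_length)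
    then show "\<exists>M. \<forall>l J A. l > 0 \<longrightarrow> (\<forall>t\<in>words k M. dens l J (A t) \<ge> \<delta>) \<longrightarrow>
      (\<exists>Q. pattern k m M Q \<and> (\<forall>x\<in>words (Suc k) m. k \<in> set x \<longrightarrow>
       dens l J (\<lambda>y. \<forall>i<k. A (subst Q (rep k i x)) y) \<ge> \<delta>))"
      using pattern_pvars by blast
  qed
next
  case False
  then have k2: "k \<ge> 2" using assms(2) by simp
  let ?K = "Suc k"
  obtain m0 \<theta> where \<theta>: "\<theta> > 0" and m0: "\<And>l J A. l > 0 \<Longrightarrow> avg k m0 (\<lambda>t. dens l J (A t)) \<ge> \<delta> \<Longrightarrow>
      \<exists>P. pattern k 1 m0 P \<and> dens l J (\<lambda>y. \<forall>a<k. A (subst P [a]) y) \<ge> \<theta>"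
    using DHJ_pigeonhole[OF assms] by (meson order_refl)
  show ?thesis
  proof (intro exI[of _ \<theta>] conjI allI \<theta>)
    fix m
    obtain n2 where n2: "\<forall>n\<ge>n2. \<forall>c. (\<forall>x\<in>words ?K n. \<forall>x'\<in>words ?K n.
      wilds k x = wilds k x' \<longrightarrow> c x = c x') \<longrightarrow>
      (\<exists>P. pattern k m n P \<and> (\<forall>x\<in>words ?K m. k \<in> set x \<longrightarrow> c (subst P x))) \<or>
      (\<exists>P. pattern k m0 n P \<and> (\<forall>x\<in>words ?K m0. k \<in> set x \<longrightarrow> \<not> c (subst P x)))"
      using good_or_bad_subspace[OF assms(1) k2, of m m0] ..
    obtain M where M: "\<forall>A :: nat list \<Rightarrow> bool. \<exists>Q. pattern k n2 M Q \<and> (\<forall>y\<in>words ?K 0.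
      \<forall>x\<in>words ?K n2. \<forall>x'\<in>words ?K n2. wilds k x = wilds k x' \<longrightarrow>
      A (y @ subst Q x) = A (y @ subst Q x'))"
      using color_depends_on_wilds[OF assms(1,2), of n2 0] ..
    show "\<exists>M. \<forall>l J A. l > 0 \<longrightarrow> (\<forall>t\<in>words k M. dens l J (A t) \<ge> \<delta>) \<longrightarrow>
      (\<exists>Q. pattern k m M Q \<and> (\<forall>x\<in>words (Suc k) m. k \<in> set x \<longrightarrow>
       dens l J (\<lambda>y. \<forall>i<k. A (subst Q (rep k i x)) y) \<ge> \<theta>))"
    proof (intro exI[of _ M] allI impI)
      fix l J and A :: "nat list \<Rightarrow> nat list \<Rightarrow> bool"
      assume l: "0 < l" and A: "\<forall>t\<in>words k M. dens l J (A t) \<ge> \<delta>"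
      define good where "good x \<longleftrightarrow> dens l J (\<lambda>y. \<forall>i<k. A (rep k i x) y) \<ge> \<theta>" for x
      obtain Q where Q: "pattern k n2 M Q" and
        dep: "\<forall>x\<in>words ?K n2. \<forall>x'\<in>words ?K n2. wilds k x = wilds k x' \<longrightarrow>
          good (subst Q x) = good (subst Q x')"
        using M[THEN spec, of good] by auto
      have rep_Q: "rep k i (subst Q (subst P x)) = subst (pcomp Q P) (rep k i x)"
        if "pattern k d n2 P" "x \<in> words ?K d" for P d i x
        using rep_subst[OF pattern_pcomp[OF Q that(1)]] subst_pcomp[OF Q] that
        by (simp add: words_length pattern_length)
      have "\<not> (\<exists>P. pattern k m0 n2 P \<and>
          (\<forall>x\<in>words ?K m0. k \<in> set x \<longrightarrow> \<not> good (subst Q (subst P x))))"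
      proof
        assume "\<exists>P. pattern k m0 n2 P \<and>
          (\<forall>x\<in>words ?K m0. k \<in> set x \<longrightarrow> \<not> good (subst Q (subst P x)))"
        then obtain P where P: "pattern k m0 n2 P"
          "\<And>x. x \<in> words ?K m0 \<Longrightarrow> k \<in> set x \<Longrightarrow> \<not> good (subst Q (subst P x))" by blast
        have "avg k m0 (\<lambda>t. dens l J (A (subst (pcomp Q P) t))) \<ge> \<delta>"
          using A subst_in_words[OF pattern_pcomp[OF Q P(1)]] by (intro avg_ge[OF assms(2)]) blast
        from m0[OF l this] obtain L where L: "pattern k 1 m0 L"
          "dens l J (\<lambda>y. \<forall>a<k. A (subst (pcomp Q P) (subst L [a])) y) \<ge> \<theta>" by blast
        \<comment> \<open>The line \<open>L\<close> read as a word with \<open>k\<close> as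
          wildcard: replacing \<open>k\<close> by \<open>i\<close> gives back its point with
          parameter \<open>i\<close>.\<close>
        define x where "x = subst L [k]"
        have x: "x \<in> words ?K m0"
          unfolding x_def by (rule subst_in_words_mono[OF L(1)]) (auto simp: words_def)
        have "Wild 0 \<in> set L" using L(1) by (auto simp: pattern_def)
        then have "k \<in> set x" by (force simp: x_def subst_def)
        moreover have "rep k i x = subst L [i]" for i
          using rep_subst[OF L(1), of "[k]"] by (simp add: x_def) (simp add: rep_def)
        then have "good (subst Q (subst P x))"
          using L(2) rep_Q[OF P(1) x] by (simp add: good_def)
        ultimately show False using P(2) x by blast
      qed
      then obtain P where P: "pattern k m n2 P"
        "\<And>x. x \<in> words ?K m \<Longrightarrow> k \<in> set x \<Longrightarrow> good (subst Q (subst P x))"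
        using n2[THEN spec, of n2, THEN mp, OF order_refl, THEN spec, of "\<lambda>x. good (subst Q x)",
            THEN mp, OF dep] by blast
      show "\<exists>Q. pattern k m M Q \<and> (\<forall>x\<in>words (Suc k) m. k \<in> set x \<longrightarrow>
         dens l J (\<lambda>y. \<forall>i<k. A (subst Q (rep k i x)) y) \<ge> \<theta>)"
        using P(2) rep_Q[OF P(1)]
        by (intro exI[of _ "pcomp Q P"] conjI pattern_pcomp[OF Q P(1)]) (auto simp: good_def)
    qed
  qed
qed

section \<open>Insensitive sets\<close>

text \<open>If some block \<open>t\<close> makes the average drop too far, another block raises it
  by at least \<open>c\<close>. Appending that block to the prefix and repeating must stop, because
  averages are at most 1. The lower bound \<open>b\<close> is fixed at the outset, so no loss
  accumulates.\<close>

lemma regular_prefix: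
  assumes "k > 0" "\<epsilon> > 0"
  shows "\<exists>N. \<forall>n\<ge>N. \<forall>f. (\<forall>w\<in>words k n. 0 \<le> f w \<and> f w \<le> 1) \<longrightarrow>
    (\<exists>l n' u. l + m + n' = n \<and> u \<in> words k l \<and>
       (\<forall>t\<in>words k m. avg k n' (\<lambda>v. f (u @ t @ v)) \<ge> avg k n f - \<epsilon>))"
proof -
  \<comment> \<open>If one of the \<open>k ^ m\<close> block averages lies more than
    \<open>\<epsilon>\<close> below their mean, some other one exceeds the mean by at least
    \<open>\<epsilon> / k ^ m\<close>.\<close>
  define c where "c = \<epsilon> / real k ^ m"
  have c: "c > 0" using assms by (simp add: c_def)
  have step: "\<exists>l n' u. l + m + n' = n \<and> u \<in> words k l \<and>
       (\<forall>t\<in>words k m. avg k n' (\<lambda>v. f (u @ t @ v)) \<ge> b)"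
    if "n \<ge> s * m" "\<forall>w\<in>words k n. f w \<le> 1" "avg k n f > 1 - real s * c" "avg k n f \<ge> b + \<epsilon>"
    for s n f b
    using that
  proof (induction s arbitrary: n f)
    case 0
    then have "avg k n f \<le> 1" using assms(1) by (intro avg_le) auto
    then show ?case using 0 by simp
  next
    case (Suc s)
    define n' where "n' = n - m"
    have n: "n = m + n'" "n' \<ge> s * m" using Suc.prems(1) by (auto simp: n'_def)
    define g where "g t = avg k n' (\<lambda>v. f (t @ v))" for t
    have fg: "avg k n f = avg k m g" by (simp add: n(1) avg_append g_def[abs_def])
    show ?case
    proof (cases "\<forall>t\<in>words k m. g t \<ge> b")
      case True
      then show ?thesis
        by (intro exI[of _ 0] exI[of _ n'] exI[of _ "[]"]) (simp add: n g_def)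
    next
      case False
      then obtain t0 where t0: "t0 \<in> words k m" "g t0 < b" by force
      have "\<exists>t\<in>words k m. g t \<ge> avg k m g + c"
      proof (rule ccontr)
        assume "\<not> ?thesis"
        then have less: "g t < avg k m g + c" if "t \<in> words k m" for t using that by force
        have "sum g (words k m) = g t0 + sum g (words k m - {t0})"
          by (rule sum.remove) (use t0 in auto)
        also have "sum g (words k m - {t0}) \<le> (\<Sum>t\<in>words k m - {t0}. avg k m g + c)"
          by (rule sum_mono) (use less in force)
        also have "\<dots> = (\<Sum>t\<in>words k m. avg k m g + c) - (avg k m g + c)"
          using sum.remove[of "words k m" t0 "\<lambda>_. avg k m g + c"] t0 by (simp del: sum_constant)
        also have "g t0 + \<dots> < (\<Sum>t\<in>words k m. avg k m g + c) - \<epsilon>"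
          using t0(2) Suc.prems(4) fg c by simp
        also have "\<dots> = real k ^ m * avg k m g"
          using assms(1) by (simp add: c_def field_simps)
        also have "\<dots> = sum g (words k m)" using assms(1) by (simp add: avg_def)
        finally show False by simp
      qed
      then obtain t where t: "t \<in> words k m" "g t \<ge> avg k n f + c" using fg by auto
      have "\<exists>l n'' u. l + m + n'' = n' \<and> u \<in> words k l \<and>
         (\<forall>t'\<in>words k m. avg k n'' (\<lambda>v. f (t @ (u @ t' @ v))) \<ge> b)"
      proof (rule Suc.IH[of n' "\<lambda>v. f (t @ v)"])
        show "\<forall>w\<in>words k n'. f (t @ w) \<le> 1"
          using Suc.prems(2) t(1) words_append n(1) by blast
        have gt: "avg k n' (\<lambda>v. f (t @ v)) \<ge> avg k n f + c" using t(2) by (simp add: g_def)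
        show "1 - real s * c < avg k n' (\<lambda>v. f (t @ v))"
          using gt Suc.prems(3) by (simp add: algebra_simps)
        show "b + \<epsilon> \<le> avg k n' (\<lambda>v. f (t @ v))" using gt Suc.prems(4) c by simp
      qed (use n(2) in simp)
      then obtain l n'' u where u: "l + m + n'' = n'" "u \<in> words k l"
        "\<forall>t'\<in>words k m. avg k n'' (\<lambda>v. f (t @ (u @ t' @ v))) \<ge> b" by blast
      show ?thesis
        by (intro exI[of _ "m + l"] exI[of _ n''] exI[of _ "t @ u"])
          (use u n(1) t(1) words_append in auto)
    qed
  qed
  obtain s where s: "real s * c > 1"
    using c reals_Archimedean3 by blast
  show ?thesis
  proof (rule exI[of _ "s * m"], intro allI impI)
    fix n and f :: "nat list \<Rightarrow> real"
    assume n: "n \<ge> s * m" and f: "\<forall>w\<in>words k n. 0 \<le> f w \<and> f w \<le> 1"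
    have "avg k n f \<ge> 0" using f by (intro avg_ge assms(1)) auto
    show "\<exists>l n' u. l + m + n' = n \<and> u \<in> words k l \<and>
       (\<forall>t\<in>words k m. avg k n' (\<lambda>v. f (u @ t @ v)) \<ge> avg k n f - \<epsilon>)"
      by (rule step[OF n]) (use f s \<open>avg k n f \<ge> 0\<close> in auto)
  qed
qed

text \<open>Comparison with the normal form free of \<open>k\<close> amounts to invariance under
  exchanging \<open>i\<close> and \<open>k\<close> at any set of positions.\<close>

definition insens :: "nat \<Rightarrow> nat \<Rightarrow> nat \<Rightarrow> (nat list \<Rightarrow> bool) \<Rightarrow> bool" where
  "insens k i n E \<longleftrightarrow> (\<forall>w\<in>words (Suc k) n. E w = E (rep k i w))"

text \<open>Here \<open>P\<close> may contain the letter \<open>k\<close>, so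
  \<open>rep_subst\<close> does not apply. Still, the images of \<open>x\<close> and
  \<open>rep k i x\<close> have the same normal form.\<close>

lemma insens_pattern:
  assumes "insens k i n E" "pattern (Suc k) d n P" "i < k"
  shows "insens k i d (\<lambda>x. E (subst P x))"
  unfolding insens_def
proof
  fix x assume x: "x \<in> words (Suc k) d"
  have x': "rep k i x \<in> words (Suc k) d"
    using rep_in_words[OF assms(3) x] words_mono[of k "Suc k"] by auto
  have "rep k i (subst P x) = rep k i (subst P (rep k i x))"
  proof -
    have "(if subst1 x e = k then i else subst1 x e) =
        (if subst1 (rep k i x) e = k then i else subst1 (rep k i x) e)" if "e \<in> set P" for e
    proof -
      have "symb_ok (Suc k) d e" using assms(2) that by (auto simp: pattern_def)
      then show ?thesis using x by (cases e) (auto simp: rep_def words_length)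
    qed
    then show ?thesis by (simp add: rep_def subst_def)
  qed
  then show "E (subst P x) = E (subst P (rep k i x))"
    using assms(1) subst_in_words[OF assms(2)] x x' unfolding insens_def by metis
qed

text \<open>A regular prefix makes the fibres over all blocks dense, in particular over those with
  letters below \<open>k\<close>. Fubini gives a suffix for which these blocks are dense, the
  theorem for \<open>k\<close> letters gives a subspace, and insensitivity admits the letter
  \<open>k\<close> as well.\<close>

lemma insensitive_contains_subspace:
  assumes "DHJ k" "i < k" "\<eta> > 0"
  shows "\<exists>n. \<forall>E. insens k i n E \<longrightarrow> dens (Suc k) n E \<ge> \<eta> \<longrightarrow>
    (\<exists>P. pattern (Suc k) d n P \<and> (\<forall>x\<in>words (Suc k) d. E (subst P x)))"
proof -
  let ?K = "Suc k"
  have k: "k > 0" using assms by simp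
  obtain m where m: "\<And>A. dens k m A \<ge> \<eta> / 2 \<Longrightarrow>
      \<exists>P. pattern k d m P \<and> (\<forall>x\<in>words k d. A (subst P x))"
    using DHJ_multidim[OF assms(1) k, of "\<eta> / 2" d] assms(3) by (meson half_gt_zero order_refl)
  obtain n where n: "\<forall>n'\<ge>n. \<forall>f. (\<forall>w\<in>words ?K n'. 0 \<le> f w \<and> f w \<le> 1) \<longrightarrow>
    (\<exists>l r u. l + m + r = n' \<and> u \<in> words ?K l \<and>
       (\<forall>t\<in>words ?K m. avg ?K r (\<lambda>v. f (u @ t @ v)) \<ge> avg ?K n' f - \<eta> / 2))"
    using regular_prefix[of ?K "\<eta> / 2" m, OF _ half_gt_zero[OF assms(3)]] by blast
  show ?thesis
  proof (intro exI[of _ n] allI impI)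
    fix E assume E: "insens k i n E" "dens ?K n E \<ge> \<eta>"
    obtain l r u where u: "l + m + r = n" "u \<in> words ?K l"
       "\<forall>t\<in>words ?K m. dens ?K r (\<lambda>v. E (u @ t @ v)) \<ge> dens ?K n E - \<eta> / 2"
      using n[rule_format, OF order_refl, of "\<lambda>w. of_bool (E w)"] by auto
    have "avg k m (\<lambda>t. dens ?K r (\<lambda>v. E (u @ t @ v))) \<ge> \<eta> / 2"
    proof (rule avg_ge[OF k])
      fix t assume "t \<in> words k m"
      then have "t \<in> words ?K m" using words_mono[of k ?K] by auto
      then have "dens ?K r (\<lambda>v. E (u @ t @ v)) \<ge> dens ?K n E - \<eta> / 2" using u(3) by blast
      then show "\<eta> / 2 \<le> dens ?K r (\<lambda>v. E (u @ t @ v))" using E(2) by linarith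
    qed
    then have "avg ?K r (\<lambda>v. dens k m (\<lambda>t. E (u @ t @ v))) \<ge> \<eta> / 2"
      by (simp add: avg_swap[of k])
    from avg_witness[OF _ this] obtain v where v: "v \<in> words ?K r"
      "dens k m (\<lambda>t. E (u @ t @ v)) \<ge> \<eta> / 2" by auto
    obtain P where P: "pattern k d m P" "\<And>x. x \<in> words k d \<Longrightarrow> E (u @ subst P x @ v)"
      using m[OF v(2)] by blast
    let ?Q = "map Letter u @ P @ map Letter v"
    have Q: "pattern ?K d n ?Q"
      using pattern_embed[OF pattern_mono[OF P(1), of ?K] u(2) v(1)] u(1) by simp
    have "E (subst ?Q x)" if "x \<in> words ?K d" for x
      using insens_pattern[OF E(1) Q assms(2)] that P(2)[OF rep_in_words[OF assms(2) that]]
      by (simp add: insens_def)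
    then show "\<exists>P. pattern ?K d n P \<and> (\<forall>x\<in>words ?K d. E (subst P x))" using Q by blast
  qed
qed

text \<open>The functional form of the statement that an insensitive set can be partitioned, up to a
  small remainder, into subspaces: a function whose average over every subspace is nonpositive
  is nearly nonpositive on average over the set.\<close>

lemma insensitive_average:
  assumes "DHJ k" "i < k" "\<eta> > 0"
  shows "\<exists>N. \<forall>n\<ge>N. \<forall>E h. insens k i n E \<longrightarrow> (\<forall>w\<in>words (Suc k) n. h w \<le> 1) \<longrightarrow>
    (\<forall>P. pattern (Suc k) d n P \<longrightarrow> avg (Suc k) d (\<lambda>x. h (subst P x)) \<le> 0) \<longrightarrow>
    avg (Suc k) n (\<lambda>w. h w * of_bool (E w)) \<le> \<eta>"
proof -
  let ?K = "Suc k"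
  \<comment> \<open>The minimum with 1 lets the full set of words qualify; this provides
    \<open>P0\<close> and hence \<open>c \<le> 1\<close>.\<close>
  obtain n0 where n0: "\<And>E. insens k i n0 E \<Longrightarrow> dens ?K n0 E \<ge> min (\<eta> / 2) 1 \<Longrightarrow>
      \<exists>P. pattern ?K d n0 P \<and> (\<forall>x\<in>words ?K d. E (subst P x))"
    using insensitive_contains_subspace[OF assms(1,2), of "min (\<eta> / 2) 1" d] assms(3) by auto
  obtain P0 where P0: "pattern ?K d n0 P0"
    using n0[of "\<lambda>_. True"] by (auto simp: insens_def)
  \<comment> \<open>The density of a \<open>d\<close>-dimensional subspace among the words of length
    \<open>n0\<close>.\<close>
  define c where "c = real (?K ^ d) / real ?K ^ n0"
  have sub_card: "card (subst P ` words ?K d) = ?K ^ d" if "pattern ?K d n0 P" for P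
    using inj_on_subst[OF that] by (simp add: card_image)
  have c: "c > 0" "c \<le> 1"
  proof -
    have "?K ^ d \<le> card (words ?K n0)"
      unfolding sub_card[OF P0, symmetric]
      by (rule card_mono) (use subst_in_words[OF P0] in auto)
    then have le: "real (?K ^ d) \<le> real ?K ^ n0" by (metis card_words of_nat_le_iff of_nat_power)
    show "c > 0" by (simp add: c_def)
    show "c \<le> 1" unfolding c_def by (rule divide_le_eq_1_pos[THEN iffD2, OF _ le]) simp
  qed
  define good where "good S \<longleftrightarrow> (\<exists>P. pattern ?K d n0 P \<and> (\<forall>x\<in>words ?K d. subst P x \<in> S))" for S
  \<comment> \<open>The chosen subspace depends on the fibre alone. Fibres over \<open>y\<close> and
    \<open>rep k i y\<close> coincide, so what remains after its removal is again insensitive in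
    \<open>y\<close>.\<close>
  define pat where "pat S = (SOME P. pattern ?K d n0 P \<and> (\<forall>x\<in>words ?K d. subst P x \<in> S))" for S
  have pat: "pattern ?K d n0 (pat S)" "\<And>x. x \<in> words ?K d \<Longrightarrow> subst (pat S) x \<in> S" if "good S" for S
    using someI_ex[OF that[unfolded good_def]] unfolding pat_def by blast+
  \<comment> \<open>In each round one subspace is removed from every fibre that contains one. The
    part removed contributes nothing positive, and the excess of the density of \<open>E\<close>
    over \<open>\<eta> / 2\<close> shrinks by the factor \<open>1 - c\<close>.\<close>
  have main: "avg ?K n (\<lambda>w. h w * of_bool (E w)) \<le> \<eta> / 2 + (1 - c) ^ s * (dens ?K n E - \<eta> / 2)"
    if "n \<ge> s * n0" "insens k i n E" "\<forall>w\<in>words ?K n. h w \<le> 1"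
      "\<forall>P. pattern ?K d n P \<longrightarrow> avg ?K d (\<lambda>x. h (subst P x)) \<le> 0" for s n E h
    using that
  proof (induction s arbitrary: n E h)
    case 0
    then have "avg ?K n (\<lambda>w. h w * of_bool (E w)) \<le> dens ?K n E" by (intro avg_mono) auto
    then show ?case by simp
  next
    case (Suc s)
    define n1 where "n1 = n - n0"
    have n: "n = n0 + n1" "n1 \<ge> s * n0" using Suc.prems(1) by (auto simp: n1_def)
    define S where "S y = {z \<in> words ?K n0. E (z @ y)}" for y
    define R where "R y z \<longleftrightarrow> good (S y) \<and> z \<in> subst (pat (S y)) ` words ?K d" for y z
    have RE: "E (z @ y)" "z \<in> words ?K n0" if "R y z" for y z
      using that pat[of "S y"] by (auto simp: R_def S_def)
    define E' where "E' z y \<longleftrightarrow> E (z @ y) \<and> \<not> R y z" for z y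
    have split: "of_bool (E (z @ y)) = of_bool (E' z y) + (of_bool (R y z) :: real)" for z y
      using RE by (auto simp: E'_def)
    have ins: "E (z @ y) = E (z @ rep k i y)" if "z \<in> words ?K n0" "y \<in> words ?K n1" for z y
    proof -
      have "rep k i y \<in> words ?K n1"
        using rep_in_words[OF assms(2) that(2)] words_mono[of k ?K] by auto
      then show ?thesis
        using Suc.prems(2) that unfolding insens_def n
        by (metis words_append rep_append rep_idem)
    qed
    then have S_rep: "S (rep k i y) = S y" if "y \<in> words ?K n1" for y
      using that by (auto simp: S_def)
    have E'_ins: "insens k i n1 (E' z)" if "z \<in> words ?K n0" for z
      using ins[OF that] S_rep by (auto simp: insens_def E'_def R_def)
    have S_ins: "insens k i n0 (\<lambda>z. E (z @ y))" if y: "y \<in> words ?K n1" for y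
      using insens_pattern[OF Suc.prems(2) _ assms(2), of n0 "pvars n0 @ map Letter y"]
        pattern_suffix[OF pattern_pvars y] n(1)
      by (auto simp: insens_def subst_pvars words_length)
    have goodI: "good (S y)" if y: "y \<in> words ?K n1" "dens ?K n0 (\<lambda>z. E (z @ y)) \<ge> \<eta> / 2" for y
    proof -
      have "dens ?K n0 (\<lambda>z. E (z @ y)) \<ge> min (\<eta> / 2) 1" using y(2) by linarith
      then obtain P where "pattern ?K d n0 P" "\<forall>x\<in>words ?K d. E (subst P x @ y)"
        using n0[OF S_ins[OF y(1)]] by blast
      then show ?thesis using subst_in_words by (auto simp: good_def S_def)
    qed
    have sumR: "avg ?K n0 (\<lambda>z. g z * of_bool (R y z)) = c * avg ?K d (\<lambda>x. g (subst (pat (S y)) x))"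
      if "good (S y)" for y g
    proof -
      let ?I = "subst (pat (S y)) ` words ?K d"
      have "?I \<subseteq> words ?K n0" using subst_in_words[OF pat(1)[OF that]] by auto
      then have "(\<Sum>z\<in>words ?K n0. g z * of_bool (R y z)) = sum g ?I"
        using that by (intro sum.mono_neutral_cong_right) (auto simp: R_def)
      also have "\<dots> = (\<Sum>x\<in>words ?K d. g (subst (pat (S y)) x))"
        using inj_on_subst[OF pat(1)[OF that]] by (simp add: sum.reindex)
      finally show ?thesis by (simp add: avg_def c_def)
    qed
    have hR: "avg ?K n0 (\<lambda>z. h (z @ y) * of_bool (R y z)) \<le> 0" if y: "y \<in> words ?K n1" for y
    proof (cases "good (S y)")
      case True
      have "pattern ?K d n (pat (S y) @ map Letter y)"
        unfolding n by (rule pattern_suffix[OF pat(1)[OF True] y])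
      then have "avg ?K d (\<lambda>x. h (subst (pat (S y)) x @ y)) \<le> 0"
        using Suc.prems(4) by fastforce
      then show ?thesis
        using sumR[OF True, of "\<lambda>z. h (z @ y)"] c(1) by (simp add: mult_nonneg_nonpos)
    next
      case False
      then show ?thesis by (simp add: R_def)
    qed
    \<comment> \<open>A fibre without a subspace has density below \<open>\<eta> / 2\<close>, which
      makes the right-hand side nonpositive.\<close>
    have dR: "dens ?K n0 (R y) \<ge> c * (dens ?K n0 (\<lambda>z. E (z @ y)) - \<eta> / 2)"
      if y: "y \<in> words ?K n1" for y
    proof (cases "good (S y)")
      case True
      have "dens ?K n0 (R y) = c"
        using sumR[OF True, of "\<lambda>_. 1"] by simp
      moreover have "dens ?K n0 (\<lambda>z. E (z @ y)) \<le> 1" by (rule dens_le_1) simp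
      ultimately show ?thesis using c assms(3) by (simp add: mult_left_le)
    next
      case False
      then have "dens ?K n0 (\<lambda>z. E (z @ y)) < \<eta> / 2" using goodI[OF y] by force
      then have "c * (dens ?K n0 (\<lambda>z. E (z @ y)) - \<eta> / 2) \<le> 0"
        using c by (simp add: mult_nonneg_nonpos)
      also have "0 \<le> dens ?K n0 (R y)" by (rule avg_ge) auto
      finally show ?thesis .
    qed
    have E_split: "dens ?K n E = avg ?K n0 (\<lambda>z. dens ?K n1 (E' z)) + avg ?K n1 (\<lambda>y. dens ?K n0 (R y))"
      unfolding n by (simp add: avg_append split avg_add avg_swap[of ?K n1])
    have "avg ?K n1 (\<lambda>y. dens ?K n0 (R y)) \<ge> avg ?K n1 (\<lambda>y. c * (dens ?K n0 (\<lambda>z. E (z @ y)) - \<eta> / 2))"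
      by (intro avg_mono dR)
    also have "avg ?K n1 (\<lambda>y. c * (dens ?K n0 (\<lambda>z. E (z @ y)) - \<eta> / 2)) = c * (dens ?K n E - \<eta> / 2)"
      unfolding n by (simp add: avg_append avg_cmult avg_diff avg_swap[of ?K n1])
    finally have E': "avg ?K n0 (\<lambda>z. dens ?K n1 (E' z)) - \<eta> / 2 \<le> (1 - c) * (dens ?K n E - \<eta> / 2)"
      using E_split by (simp only: left_diff_distrib mult_1)
    have "avg ?K n (\<lambda>w. h w * of_bool (E w)) =
        avg ?K n0 (\<lambda>z. avg ?K n1 (\<lambda>y. h (z @ y) * of_bool (E' z y))) +
        avg ?K n1 (\<lambda>y. avg ?K n0 (\<lambda>z. h (z @ y) * of_bool (R y z)))"
      unfolding n by (simp add: avg_append split distrib_left avg_add avg_swap[of ?K n1])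
    also have "avg ?K n1 (\<lambda>y. avg ?K n0 (\<lambda>z. h (z @ y) * of_bool (R y z))) \<le> 0"
      by (intro avg_le hR) simp_all
    also have "avg ?K n0 (\<lambda>z. avg ?K n1 (\<lambda>y. h (z @ y) * of_bool (E' z y))) \<le>
        avg ?K n0 (\<lambda>z. \<eta> / 2 + (1 - c) ^ s * (dens ?K n1 (E' z) - \<eta> / 2))"
    proof (rule avg_mono)
      fix z assume z: "z \<in> words ?K n0"
      show "avg ?K n1 (\<lambda>y. h (z @ y) * of_bool (E' z y)) \<le>
          \<eta> / 2 + (1 - c) ^ s * (dens ?K n1 (E' z) - \<eta> / 2)"
      proof (rule Suc.IH[OF n(2) E'_ins[OF z]])
        show "\<forall>w\<in>words ?K n1. h (z @ w) \<le> 1"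
          using Suc.prems(3) words_append[OF z] n(1) by blast
        show "\<forall>P. pattern ?K d n1 P \<longrightarrow> avg ?K d (\<lambda>x. h (z @ subst P x)) \<le> 0"
        proof (intro allI impI)
          fix P assume "pattern ?K d n1 P"
          then have "pattern ?K d n (map Letter z @ P)"
            unfolding n by (rule pattern_prefix[OF _ z])
          then show "avg ?K d (\<lambda>x. h (z @ subst P x)) \<le> 0" using Suc.prems(4) by fastforce
        qed
      qed
    qed
    also have "\<dots> = \<eta> / 2 + (1 - c) ^ s * (avg ?K n0 (\<lambda>z. dens ?K n1 (E' z)) - \<eta> / 2)"
      by (simp add: avg_add avg_cmult avg_diff)
    also have "\<dots> \<le> \<eta> / 2 + (1 - c) ^ s * ((1 - c) * (dens ?K n E - \<eta> / 2))"
      using E' c by (intro add_left_mono mult_left_mono) auto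
    finally show ?case by (simp only: power_Suc2 mult.assoc add_0_right)
  qed
  obtain s where s: "(1 - c) ^ s < \<eta> / 2"
    using real_arch_pow_inv[of "\<eta> / 2" "1 - c"] c assms(3) by auto
  show ?thesis
  proof (intro exI[of _ "s * n0"] allI impI)
    fix n E h
    assume *: "s * n0 \<le> n" "insens k i n E" "\<forall>w\<in>words ?K n. h w \<le> 1"
      "\<forall>P. pattern ?K d n P \<longrightarrow> avg ?K d (\<lambda>x. h (subst P x)) \<le> 0"
    have "dens ?K n E \<le> 1" by (rule dens_le_1) simp
    then have "(1 - c) ^ s * (dens ?K n E - \<eta> / 2) \<le> (1 - c) ^ s * 1"
      using c assms(3) by (intro mult_left_mono) auto
    then show "avg ?K n (\<lambda>w. h w * of_bool (E w)) \<le> \<eta>"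
      using main[OF *] s by simp
  qed
qed

text \<open>Induction on the number of sets. By the induction hypothesis on
  \<open>m\<close>-dimensional subspaces, \<open>h\<close> restricted to the first \<open>r\<close>
  sets and lowered by \<open>\<eta> / 2\<close> has nonpositive averages there, so
  \<open>insensitive_average\<close> handles the last set. With no sets left, the whole space is
  averaged over translates of one subspace.\<close>

lemma insensitive_intersection_average:
  assumes "DHJ k" "r \<le> k" "\<eta> > 0"
  shows "\<exists>N. \<forall>n\<ge>N. \<forall>D h. (\<forall>i<r. insens k i n (D i)) \<longrightarrow> (\<forall>w\<in>words (Suc k) n. h w \<le> 1) \<longrightarrow>
    (\<forall>P. pattern (Suc k) d n P \<longrightarrow> avg (Suc k) d (\<lambda>x. h (subst P x)) \<le> 0) \<longrightarrow>
    avg (Suc k) n (\<lambda>w. h w * of_bool (\<forall>i<r. D i w)) \<le> \<eta>"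
  using assms(2,3)
proof (induction r arbitrary: \<eta> d)
  case 0
  let ?K = "Suc k"
  show ?case
  proof (rule exI[of _ d], intro allI impI)
    fix n and D :: "nat \<Rightarrow> nat list \<Rightarrow> bool" and h
    assume n: "d \<le> n" and h: "\<forall>P. pattern ?K d n P \<longrightarrow> avg ?K d (\<lambda>x. h (subst P x)) \<le> 0"
    define l where "l = n - d"
    have l: "n = l + d" using n by (simp add: l_def)
    have "avg ?K n h = avg ?K l (\<lambda>u. avg ?K d (\<lambda>v. h (u @ v)))" by (simp add: l avg_append)
    also have "\<dots> \<le> 0"
    proof (rule avg_le)
      fix u assume u: "u \<in> words ?K l"
      have "avg ?K d (\<lambda>v. h (subst (map Letter u @ pvars d) v)) \<le> 0"
        using h pattern_prefix[OF pattern_pvars u] l by blast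
      moreover have "avg ?K d (\<lambda>v. h (subst (map Letter u @ pvars d) v)) = avg ?K d (\<lambda>v. h (u @ v))"
        by (rule avg_cong) (simp add: subst_pvars words_length)
      ultimately show "avg ?K d (\<lambda>v. h (u @ v)) \<le> 0" by simp
    qed simp
    finally show "avg ?K n (\<lambda>w. h w * of_bool (\<forall>i<0. D i w)) \<le> \<eta>" using 0 by simp
  qed
next
  case (Suc r)
  let ?K = "Suc k"
  have r: "r < k" "r \<le> k" and \<eta>2: "\<eta> / 2 > 0" using Suc.prems by auto
  obtain m where m: "\<forall>n\<ge>m. \<forall>D h. (\<forall>i<r. insens k i n (D i)) \<longrightarrow> (\<forall>w\<in>words ?K n. h w \<le> 1) \<longrightarrow>
    (\<forall>P. pattern ?K d n P \<longrightarrow> avg ?K d (\<lambda>x. h (subst P x)) \<le> 0) \<longrightarrow>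
    avg ?K n (\<lambda>w. h w * of_bool (\<forall>i<r. D i w)) \<le> \<eta> / 2"
    using Suc.IH[OF r(2) \<eta>2] ..
  obtain N where N: "\<forall>n\<ge>N. \<forall>E h. insens k r n E \<longrightarrow> (\<forall>w\<in>words ?K n. h w \<le> 1) \<longrightarrow>
    (\<forall>P. pattern ?K m n P \<longrightarrow> avg ?K m (\<lambda>x. h (subst P x)) \<le> 0) \<longrightarrow>
    avg ?K n (\<lambda>w. h w * of_bool (E w)) \<le> \<eta> / 2"
    using insensitive_average[OF assms(1) r(1) \<eta>2] ..
  show ?case
  proof (rule exI[of _ N], intro allI impI)
    fix n D h
    assume n: "N \<le> n" and D: "\<forall>i<Suc r. insens k i n (D i)" and h1: "\<forall>w\<in>words ?K n. h w \<le> 1"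
      and h: "\<forall>P. pattern ?K d n P \<longrightarrow> avg ?K d (\<lambda>x. h (subst P x)) \<le> 0"
    define g where "g w = h w * of_bool (\<forall>i<r. D i w) - \<eta> / 2" for w
    have "avg ?K n (\<lambda>w. g w * of_bool (D r w)) \<le> \<eta> / 2"
    proof (rule N[rule_format, OF n])
      show "insens k r n (D r)" using D by simp
    next
      fix w assume "w \<in> words ?K n"
      then have "h w * of_bool (\<forall>i<r. D i w) \<le> 1" using h1 by auto
      then show "g w \<le> 1" using \<eta>2 by (simp add: g_def)
    next
      fix P assume P: "pattern ?K m n P"
      have "avg ?K m (\<lambda>x. h (subst P x) * of_bool (\<forall>i<r. D i (subst P x))) \<le> \<eta> / 2"
      proof (rule m[rule_format, OF order_refl, where D = "\<lambda>i x. D i (subst P x)"])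
        fix i assume "i < r"
        then show "insens k i m (\<lambda>x. D i (subst P x))"
          using D insens_pattern[of k i n "D i" m P] P r by simp
      next
        fix w assume "w \<in> words ?K m"
        then show "h (subst P w) \<le> 1" using h1 subst_in_words[OF P] by blast
      next
        fix R assume R: "pattern ?K d m R"
        have "avg ?K d (\<lambda>x. h (subst (pcomp P R) x)) \<le> 0" using h pattern_pcomp[OF P R] by blast
        then show "avg ?K d (\<lambda>x. h (subst P (subst R x))) \<le> 0"
          using subst_pcomp[OF P pattern_length[OF R]] by simp
      qed
      then show "avg ?K m (\<lambda>x. g (subst P x)) \<le> 0" by (simp add: g_def avg_diff)
    qed
    moreover have "h w * of_bool (\<forall>i<Suc r. D i w) = g w * of_bool (D r w) + \<eta> / 2 * of_bool (D r w)" for w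
      by (auto simp: g_def less_Suc_eq)
    then have "avg ?K n (\<lambda>w. h w * of_bool (\<forall>i<Suc r. D i w)) =
        avg ?K n (\<lambda>w. g w * of_bool (D r w)) + \<eta> / 2 * dens ?K n (D r)"
      by (simp only: avg_add avg_cmult)
    moreover have "\<eta> / 2 * dens ?K n (D r) \<le> \<eta> / 2 * 1"
      using \<eta>2 by (intro mult_left_mono dens_le_1) auto
    ultimately show "avg ?K n (\<lambda>w. h w * of_bool (\<forall>i<Suc r. D i w)) \<le> \<eta>" by simp
  qed
qed

section \<open>The density increment\<close>

lemma dens_missing_letter: "dens (Suc k) m (\<lambda>x. k \<notin> set x) = (real k / real (Suc k)) ^ m"
proof -
  have "(\<Sum>x\<in>words (Suc k) m. of_bool (k \<notin> set x)) = (\<Sum>x\<in>words k m. (1::real))"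
    by (rule sum.mono_neutral_cong_right[OF finite_words])
      (auto simp: words_def subset_iff less_Suc_eq)
  then show ?thesis by (simp add: avg_def power_divide)
qed

text \<open>Sorting by the first failing index splits the complement of an intersection of
  insensitive sets into disjoint intersections of insensitive sets.\<close>

lemma first_failure:
  fixes k :: nat
  shows
  "of_bool (\<not> (\<forall>i<k. D i)) = (\<Sum>j<k. of_bool ((\<forall>i<j. D i) \<and> \<not> D j) :: real)"
proof (induction k)
  case (Suc k)
  have "of_bool (\<not> (\<forall>i<Suc k. D i)) =
      of_bool (\<not> (\<forall>i<k. D i)) + (of_bool ((\<forall>i<k. D i) \<and> \<not> D k) :: real)"
    by (auto simp: less_Suc_eq)
  then show ?case by (simp only: sum.lessThan_Suc Suc)
qed simp

text \<open>The gain \<open>\<gamma>\<close> is chosen before \<open>d\<close>, so that it stays the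
  same throughout the iteration. Without the increment, the words in \<open>C y\<close> would have
  average density at least \<open>\<theta> / 2\<close>, but also at most
  \<open>3 * \<gamma> / \<beta>\<close>.\<close>

lemma density_increment:
  assumes "DHJ k" "k > 0" "\<delta> > 0" "\<delta> \<le> 1"
  shows "\<exists>\<gamma>>0. \<forall>d. \<exists>N. \<forall>n\<ge>N. \<forall>A. dens (Suc k) n A \<ge> \<delta> \<longrightarrow>
    \<not> (\<exists>P. pattern (Suc k) 1 n P \<and> (\<forall>a<Suc k. A (subst P [a]))) \<longrightarrow>
    (\<exists>P. pattern (Suc k) d n P \<and> dens (Suc k) d (\<lambda>x. A (subst P x)) > dens (Suc k) n A + \<gamma>)"
proof -
  let ?K = "Suc k"
  obtain \<theta>0 where \<theta>0: "\<theta>0 > 0" and good0: "\<forall>m. \<exists>M. \<forall>l J A. l > 0 \<longrightarrow> (\<forall>t\<in>words k M. dens l J (A t) \<ge> \<delta> / 2) \<longrightarrow>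
    (\<exists>Q. pattern k m M Q \<and> (\<forall>x\<in>words ?K m. k \<in> set x \<longrightarrow>
       dens l J (\<lambda>y. \<forall>i<k. A (subst Q (rep k i x)) y) \<ge> \<theta>0))"
    using good_subspace[OF assms(1,2) half_gt_zero[OF assms(3)]] by blast
  \<comment> \<open>Bounding \<open>\<theta>\<close> by 1 gives
    \<open>\<gamma> \<le> \<delta> / 2\<close>, so fibres of density at least
    \<open>\<delta> - \<gamma>\<close> are dense enough for \<open>good0\<close>.\<close>
  define \<theta> where "\<theta> = min \<theta>0 1"
  \<comment> \<open>The final contradiction needs
    \<open>3 * \<gamma> < \<delta> * \<theta> / 2\<close>.\<close>
  define \<gamma> where "\<gamma> = \<delta> * \<theta> / 8"
  \<comment> \<open>There are \<open>k + 1\<close> errors of size \<open>\<eta>\<close>: one for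
    each piece of the complement of \<open>C y\<close> and one for the words without the letter
    \<open>k\<close>.\<close>
  define \<eta> where "\<eta> = \<gamma> / (real k + 1)"
  have \<theta>: "\<theta> > 0" "\<theta> \<le> 1" using \<theta>0 by (auto simp: \<theta>_def)
  have \<gamma>: "\<gamma> > 0" "\<gamma> \<le> \<delta> / 2" using \<theta> assms(3) by (auto simp: \<gamma>_def mult_left_le)
  have \<eta>: "\<eta> > 0" "(real k + 1) * \<eta> = \<gamma>" using \<gamma> by (auto simp: \<eta>_def)
  show ?thesis
  proof (rule exI[of _ \<gamma>], intro conjI allI \<gamma>(1))
    fix d
    obtain m1 where m1: "\<forall>n\<ge>m1. \<forall>D h. (\<forall>i<k. insens k i n (D i)) \<longrightarrow> (\<forall>w\<in>words ?K n. h w \<le> 1) \<longrightarrow>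
      (\<forall>P. pattern ?K d n P \<longrightarrow> avg ?K d (\<lambda>x. h (subst P x)) \<le> 0) \<longrightarrow>
      avg ?K n (\<lambda>w. h w * of_bool (\<forall>i<k. D i w)) \<le> \<eta>"
      using insensitive_intersection_average[OF assms(1) order_refl \<eta>(1)] ..
    obtain m2 where m2: "(real k / real ?K) ^ m2 < min \<eta> (1/2)"
      using real_arch_pow_inv[of "min \<eta> (1/2)" "real k / real ?K"] \<eta>(1) by auto
    define m where "m = max m1 m2"
    define \<mu> where "\<mu> = (real k / real ?K) ^ m"
    have "\<mu> \<le> (real k / real ?K) ^ m2"
      unfolding \<mu>_def by (rule power_decreasing) (auto simp: m_def)
    then have \<mu>: "\<mu> \<le> \<eta>" "\<mu> \<le> 1 / 2" using m2 by auto
    obtain M where M: "\<forall>l J A. l > 0 \<longrightarrow> (\<forall>t\<in>words k M. dens l J (A t) \<ge> \<delta> / 2) \<longrightarrow>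
      (\<exists>Q. pattern k m M Q \<and> (\<forall>x\<in>words ?K m. k \<in> set x \<longrightarrow>
         dens l J (\<lambda>y. \<forall>i<k. A (subst Q (rep k i x)) y) \<ge> \<theta>0))"
      using good0 by blast
    obtain N where N: "\<forall>n\<ge>N. \<forall>f. (\<forall>w\<in>words ?K n. 0 \<le> f w \<and> f w \<le> 1) \<longrightarrow>
      (\<exists>l n' u. l + M + n' = n \<and> u \<in> words ?K l \<and>
       (\<forall>t\<in>words ?K M. avg ?K n' (\<lambda>v. f (u @ t @ v)) \<ge> avg ?K n f - \<gamma>))"
      using regular_prefix[of ?K \<gamma> M, OF _ \<gamma>(1)] by blast
    show "\<exists>N. \<forall>n\<ge>N. \<forall>A. dens ?K n A \<ge> \<delta> \<longrightarrow>
      \<not> (\<exists>P. pattern ?K 1 n P \<and> (\<forall>a<?K. A (subst P [a]))) \<longrightarrow>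
      (\<exists>P. pattern ?K d n P \<and> dens ?K d (\<lambda>x. A (subst P x)) > dens ?K n A + \<gamma>)"
    proof (rule exI[of _ N], intro allI impI, rule ccontr)
      fix n A
      assume n: "N \<le> n" and A: "\<delta> \<le> dens ?K n A"
        and line: "\<not> (\<exists>P. pattern ?K 1 n P \<and> (\<forall>a<?K. A (subst P [a])))"
        and no: "\<not> (\<exists>P. pattern ?K d n P \<and> dens ?K d (\<lambda>x. A (subst P x)) > dens ?K n A + \<gamma>)"
      define \<beta> where "\<beta> = dens ?K n A + \<gamma>"
      have \<beta>: "\<beta> > 0" using A assms(3) \<gamma> by (simp add: \<beta>_def)
      obtain l n' u where u: "l + M + n' = n" "u \<in> words ?K l"
        "\<forall>t\<in>words ?K M. dens ?K n' (\<lambda>v. A (u @ t @ v)) \<ge> dens ?K n A - \<gamma>"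
        using N[rule_format, OF n, of "\<lambda>w. of_bool (A w)"] by auto
      have "\<forall>t\<in>words k M. dens ?K n' (\<lambda>v. A (u @ t @ v)) \<ge> \<delta> / 2"
      proof
        fix t assume "t \<in> words k M"
        then have "t \<in> words ?K M" using words_mono[of k ?K] by auto
        then show "dens ?K n' (\<lambda>v. A (u @ t @ v)) \<ge> \<delta> / 2" using u(3) A \<gamma> by force
      qed
      then have "\<exists>Q. pattern k m M Q \<and> (\<forall>x\<in>words ?K m. k \<in> set x \<longrightarrow>
         dens ?K n' (\<lambda>y. \<forall>i<k. A (u @ subst Q (rep k i x) @ y)) \<ge> \<theta>0)"
        by (rule M[THEN spec, of ?K, THEN spec, of n', THEN spec, of "\<lambda>t v. A (u @ t @ v)",
              THEN mp, OF zero_less_Suc, THEN mp])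
      then obtain Q where Q: "pattern k m M Q" "\<And>x. x \<in> words ?K m \<Longrightarrow> k \<in> set x \<Longrightarrow>
         dens ?K n' (\<lambda>y. \<forall>i<k. A (u @ subst Q (rep k i x) @ y)) \<ge> \<theta>0"
        by blast
      have QK: "pattern ?K m M Q" using pattern_mono[OF Q(1)] by simp
      define D where "D y i x \<longleftrightarrow> A (u @ subst Q (rep k i x) @ y)" for y i x
      define B where "B y x \<longleftrightarrow> A (u @ subst Q x @ y)" for y x
      define C where "C y x \<longleftrightarrow> (\<forall>i<k. D y i x)" for y x
      have D_ins: "insens k i m (D y i)" for y i
        by (simp add: insens_def D_def)
      have pat: "pattern ?K e n (map Letter u @ pcomp Q P @ map Letter y)"
        "subst (map Letter u @ pcomp Q P @ map Letter y) x = u @ subst Q (subst P x) @ y"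
        if "pattern ?K e m P" "y \<in> words ?K n'" for e P y x
        using pattern_embed[OF pattern_pcomp[OF QK that(1)] u(2) that(2)] u(1)
          subst_pcomp[OF QK pattern_length[OF that(1)]] by (auto simp: add.assoc)
      \<comment> \<open>A word in both sets that contains \<open>k\<close> becomes a line inside
        \<open>A\<close> when \<open>k\<close> is read as the wildcard.\<close>
      have BC: "k \<notin> set x" if "y \<in> words ?K n'" "x \<in> words ?K m" "B y x" "C y x" for x y
      proof
        assume k: "k \<in> set x"
        define L where "L = map (\<lambda>a. if a = k then Wild 0 else Letter a) x"
        have L: "pattern ?K 1 m L"
          using that(2) k by (auto simp: pattern_def L_def words_def)
        have "subst L [a] = rep k a x" for a
          by (auto simp: subst_def L_def rep_def)
        then have sub: "subst (pcomp Q L) [a] = subst Q (rep k a x)" for a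
          using subst_pcomp[OF QK pattern_length[OF L]] by simp
        have "rep k k x = x" by (simp add: rep_def map_idI)
        then have "\<forall>a<?K. A (subst (map Letter u @ pcomp Q L @ map Letter y) [a])"
          using that(3,4) by (auto simp: sub B_def C_def D_def less_Suc_eq)
        then show False using line pat(1)[OF L that(1)] by blast
      qed
      \<comment> \<open>The balanced function \<open>h\<close> has small average off
        \<open>C y\<close>, by the result on insensitive intersections. On \<open>C y\<close> the
        set \<open>B y\<close> is almost absent, so \<open>h\<close> is mostly
        \<open>- \<beta>\<close> there.\<close>
      have each: "dens ?K m (B y) \<le> \<beta> + \<gamma> - \<beta> * dens ?K m (C y)" if y: "y \<in> words ?K n'" for y
      proof -
        define h where "h x = of_bool (B y x) - \<beta>" for x
        have h1: "h w \<le> 1" for w using \<beta> by (simp add: h_def)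
        have hP: "avg ?K d (\<lambda>x. h (subst P x)) \<le> 0" if P: "pattern ?K d m P" for P
          using no pat(1)[OF P y] pat(2)[OF P y]
          by (force simp: h_def avg_diff B_def \<beta>_def not_less)
        have "avg ?K m (\<lambda>x. h x * of_bool ((\<forall>i<j. D y i x) \<and> \<not> D y j x)) \<le> \<eta>" if j: "j < k" for j
        proof -
          \<comment> \<open>The first \<open>j\<close> sets and the complement of the next one,
            padded with the full set to a family of \<open>k\<close> insensitive sets.\<close>
          let ?E = "\<lambda>i x. if i < j then D y i x else if i = j then \<not> D y j x else True"
          have "avg ?K m (\<lambda>x. h x * of_bool (\<forall>i<k. ?E i x)) \<le> \<eta>"
          proof (rule m1[rule_format, where D = ?E])
            fix i assume "i < k"
            show "insens k i m (?E i)" using D_ins[of i y] by (auto simp: insens_def)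
          qed (use hP h1 in \<open>auto simp: m_def\<close>)
          moreover have "(\<forall>i<k. ?E i x) \<longleftrightarrow> (\<forall>i<j. D y i x) \<and> \<not> D y j x" for x
            using j by (metis less_irrefl less_trans)
          ultimately show ?thesis by simp
        qed
        then have "(\<Sum>j<k. avg ?K m (\<lambda>x. h x * of_bool ((\<forall>i<j. D y i x) \<and> \<not> D y j x))) \<le> real (card {..<k}) * \<eta>"
          by (intro sum_bounded_above) auto
        also have "(\<Sum>j<k. avg ?K m (\<lambda>x. h x * of_bool ((\<forall>i<j. D y i x) \<and> \<not> D y j x))) =
            avg ?K m (\<lambda>x. h x * of_bool (\<not> C y x))"
          by (simp only: C_def first_failure sum_distrib_left avg_sum)
        finally have 1: "avg ?K m (\<lambda>x. h x * of_bool (\<not> C y x)) \<le> real k * \<eta>" by simp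
        have "avg ?K m (\<lambda>x. h x * of_bool (C y x)) \<le> avg ?K m (\<lambda>x. of_bool (k \<notin> set x) - \<beta> * of_bool (C y x))"
          by (rule avg_mono) (use BC[OF y] in \<open>auto simp: h_def\<close>)
        also have "\<dots> = \<mu> - \<beta> * dens ?K m (C y)"
          by (simp only: avg_diff avg_cmult dens_missing_letter \<mu>_def)
        finally have 2: "avg ?K m (\<lambda>x. h x * of_bool (C y x)) \<le> \<mu> - \<beta> * dens ?K m (C y)" .
        have "avg ?K m h = avg ?K m (\<lambda>x. h x * of_bool (\<not> C y x) + h x * of_bool (C y x))"
          by (rule avg_cong) auto
        also have "\<dots> \<le> real k * \<eta> + (\<mu> - \<beta> * dens ?K m (C y))" using 1 2 by (simp add: avg_add)
        finally have "dens ?K m (B y) - \<beta> \<le> real k * \<eta> + \<eta> - \<beta> * dens ?K m (C y)"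
          using \<mu>(1) by (simp add: h_def[abs_def] avg_diff)
        then show ?thesis using \<eta>(2) by (simp add: algebra_simps)
      qed
      have "dens ?K n A - \<gamma> \<le> avg ?K m (\<lambda>x. dens ?K n' (\<lambda>y. B y x))"
        by (rule avg_ge) (use u(3) subst_in_words[OF QK] in \<open>auto simp: B_def\<close>)
      also have "\<dots> = avg ?K n' (\<lambda>y. dens ?K m (B y))" by (rule avg_swap)
      also have "\<dots> \<le> avg ?K n' (\<lambda>y. \<beta> + \<gamma> - \<beta> * dens ?K m (C y))" by (intro avg_mono each)
      also have "\<dots> = \<beta> + \<gamma> - \<beta> * avg ?K n' (\<lambda>y. dens ?K m (C y))"
        by (simp add: avg_diff avg_cmult)
      finally have upper: "\<beta> * avg ?K n' (\<lambda>y. dens ?K m (C y)) \<le> 3 * \<gamma>" by (simp add: \<beta>_def)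
      \<comment> \<open>Lower bound for the average size of \<open>C y\<close>, by counting pairs
        from the side of \<open>x\<close>: each \<open>x\<close> containing \<open>k\<close>
        contributes at least \<open>\<theta>\<close>, and such words make up at least half of
        all.\<close>
      have "\<theta> / 2 \<le> \<theta> * (1 - \<mu>)" using \<theta> \<mu>(2) by (simp add: field_simps)
      also have "\<dots> = avg ?K m (\<lambda>x. \<theta> * (1 - of_bool (k \<notin> set x)))"
        by (simp only: avg_cmult avg_diff dens_missing_letter \<mu>_def) simp
      also have "\<dots> \<le> avg ?K m (\<lambda>x. dens ?K n' (\<lambda>y. C y x))"
      proof (rule avg_mono)
        fix x assume x: "x \<in> words ?K m"
        show "\<theta> * (1 - of_bool (k \<notin> set x)) \<le> dens ?K n' (\<lambda>y. C y x)"
        proof (cases "k \<in> set x")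
          case True
          then show ?thesis using Q(2)[OF x] by (simp add: C_def D_def \<theta>_def)
        next
          case False
          then show ?thesis by (simp add: avg_ge)
        qed
      qed
      also have "\<dots> = avg ?K n' (\<lambda>y. dens ?K m (C y))" by (rule avg_swap)
      finally have "\<delta> * (\<theta> / 2) \<le> \<beta> * avg ?K n' (\<lambda>y. dens ?K m (C y))"
        using A \<gamma> \<theta> \<beta> by (intro mult_mono) (auto simp: \<beta>_def)
      then have "\<delta> * (\<theta> / 2) \<le> 3 * \<gamma>" using upper by linarith
      then show False using \<theta> assms(3) by (simp add: \<gamma>_def)
    qed
  qed
qed

lemma DHJ_Suc:
  assumes "DHJ k" "k > 0"
  shows "DHJ (Suc k)"
  unfolding DHJ_def
proof (intro allI impI)
  fix \<delta> :: real
  assume \<delta>: "\<delta> > 0"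
  let ?K = "Suc k"
  define \<delta>' where "\<delta>' = min \<delta> 1"
  have \<delta>': "\<delta>' > 0" "\<delta>' \<le> 1" "\<delta>' \<le> \<delta>" using \<delta> by (auto simp: \<delta>'_def)
  define L where "L n A \<longleftrightarrow> (\<exists>P. pattern ?K 1 n P \<and> (\<forall>a<?K. A (subst P [a])))" for n A
  obtain \<gamma> where \<gamma>: "\<gamma> > 0" and inc: "\<And>d. \<exists>N. \<forall>n\<ge>N. \<forall>A. dens ?K n A \<ge> \<delta>' \<longrightarrow> \<not> L n A \<longrightarrow>
    (\<exists>P. pattern ?K d n P \<and> dens ?K d (\<lambda>x. A (subst P x)) > dens ?K n A + \<gamma>)"
    using density_increment[OF assms \<delta>'(1,2)] unfolding L_def by blast
  \<comment> \<open>Each increment lowers \<open>s\<close> by one. Dimensions are found backwards: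
    the length sufficient for \<open>s\<close> is the dimension \<open>d\<close> demanded of the
    increment for \<open>Suc s\<close>.\<close>
  have step: "\<exists>N. \<forall>n\<ge>N. \<forall>A. dens ?K n A \<ge> \<delta>' \<longrightarrow> dens ?K n A > 1 - real s * \<gamma> \<longrightarrow> L n A" for s
  proof (induction s)
    case 0
    have "\<not> dens ?K n A > 1 - real 0 * \<gamma>" for n A using dens_le_1[of ?K n A] by simp
    then show ?case by blast
  next
    case (Suc s)
    then obtain d where d: "\<forall>n\<ge>d. \<forall>A. dens ?K n A \<ge> \<delta>' \<longrightarrow> dens ?K n A > 1 - real s * \<gamma> \<longrightarrow> L n A" ..
    obtain N where N: "\<forall>n\<ge>N. \<forall>A. dens ?K n A \<ge> \<delta>' \<longrightarrow> \<not> L n A \<longrightarrow>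
      (\<exists>P. pattern ?K d n P \<and> dens ?K d (\<lambda>x. A (subst P x)) > dens ?K n A + \<gamma>)"
      using inc ..
    show ?case
    proof (rule exI[of _ N], intro allI impI, rule ccontr)
      fix n A
      assume n: "N \<le> n" and A: "\<delta>' \<le> dens ?K n A" "1 - real (Suc s) * \<gamma> < dens ?K n A" and L: "\<not> L n A"
      obtain P where P: "pattern ?K d n P" "dens ?K d (\<lambda>x. A (subst P x)) > dens ?K n A + \<gamma>"
        using N n A(1) L by blast
      have "L d (\<lambda>x. A (subst P x))"
        using d[rule_format, of d "\<lambda>x. A (subst P x)"] P(2) A \<gamma> by (simp add: algebra_simps)
      then obtain R where R: "pattern ?K 1 d R" "\<forall>a<?K. A (subst P (subst R [a]))"
        unfolding L_def by blast
      then have "L n A"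
        unfolding L_def using pattern_pcomp[OF P(1) R(1)] subst_pcomp[OF P(1) pattern_length[OF R(1)]]
        by metis
      then show False using L by simp
    qed
  qed
  obtain s where s: "real s * \<gamma> > 1" using \<gamma> reals_Archimedean3 by blast
  obtain N where N: "\<forall>n\<ge>N. \<forall>A. dens ?K n A \<ge> \<delta>' \<longrightarrow> dens ?K n A > 1 - real s * \<gamma> \<longrightarrow> L n A"
    using step[of s] ..
  have "L n A" if "n \<ge> N" "dens ?K n A \<ge> \<delta>" for n A
  proof -
    have "dens ?K n A \<ge> \<delta>'" using that(2) \<delta>' by linarith
    moreover have "dens ?K n A > 1 - real s * \<gamma>" using calculation \<delta>' s by linarith
    ultimately show ?thesis using N that(1) by blast
  qed
  then show "\<exists>N. \<forall>n\<ge>N. \<forall>A. dens ?K n A \<ge> \<delta> \<longrightarrow> (\<exists>P. pattern ?K 1 n P \<and> (\<forall>a<?K. A (subst P [a])))"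
    unfolding L_def by blast
qed

theorem density_Hales_Jewett: "k > 0 \<Longrightarrow> DHJ k"
proof (induction k rule: nat_induct_non_zero)
  case 1
  show ?case
    unfolding DHJ_def
  proof (intro allI impI, rule exI[of _ 1], intro allI impI)
    fix \<delta> :: real and n A
    assume "\<delta> > 0" "1 \<le> n" "\<delta> \<le> dens 1 n A"
    then obtain w where w: "w \<in> words 1 n" "\<delta> \<le> of_bool (A w)"
      using avg_witness[of 1 \<delta> n "\<lambda>w. of_bool (A w)"] by auto
    have Aw: "A w" using w(2) \<open>\<delta> > 0\<close> by (cases "A w") auto
    have "w = replicate n 0"
      using w(1) by (auto simp: words_def intro!: replicate_eqI)
    \<comment> \<open>The only word of length \<open>n\<close> is a line with every position a
      wildcard; its wildcard occurs because \<open>n\<close> is at least 1.\<close>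
    then show "\<exists>P. pattern 1 1 n P \<and> (\<forall>a<1. A (subst P [a]))"
      using Aw \<open>1 \<le> n\<close>
      by (intro exI[of _ "replicate n (Wild 0)"]) (auto simp: pattern_def subst_def)
  qed
next
  case (Suc k)
  then show ?case by (intro DHJ_Suc)
qed

section \<open>Real analytic functions on lines\<close>

lemma finite_multi_indices_degree:
  "finite {k \<in> multi_indices :: ('a::euclidean_space \<Rightarrow> nat) set. sum k Basis = j}"
proof (rule finite_subset)
  show "{k \<in> multi_indices :: ('a \<Rightarrow> nat) set. sum k Basis = j} \<subseteq> Basis \<rightarrow>\<^sub>E {..j}"
    by (auto simp: multi_indices_def PiE_def intro: member_le_sum)
  show "finite ((Basis :: 'a set) \<rightarrow>\<^sub>E {..j})" by (intro finite_PiE) auto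
qed

lemma monomial_scaleR: "monomial k (s *\<^sub>R u) = s ^ sum k Basis * monomial k u"
  by (simp add: monomial_def power_mult_distrib prod.distrib power_sum)

text \<open>Unconditional summability permits grouping the terms by total degree. Each group is
  finite, and on the line it is a multiple of a power of \<open>s\<close>.\<close>

lemma real_analytic_line_powser:
  fixes f :: "'a::euclidean_space \<Rightarrow> real"
  assumes "real_analytic_at f p"
  obtains R b where "R > 0" "\<And>s. \<bar>s\<bar> < R \<Longrightarrow> (\<lambda>j. b j * s ^ j) sums f (p + s *\<^sub>R u)"
proof -
  obtain r c where r: "r > 0"
    and c: "\<And>x. x \<in> ball p r \<Longrightarrow> ((\<lambda>k. c k * monomial k (x - p)) has_sum f x) multi_indices"
    using assms unfolding real_analytic_at_def by blast
  define M where "M j = {k \<in> multi_indices :: ('a \<Rightarrow> nat) set. sum k Basis = j}" for j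
  define b where "b j = (\<Sum>k\<in>M j. c k * monomial k u)" for j
  \<comment> \<open>The summand 1 covers \<open>u = 0\<close>.\<close>
  define R where "R = r / (norm u + 1)"
  have nu: "norm u + 1 > 0" by (simp add: add_nonneg_pos)
  have "R > 0" using r nu by (simp add: R_def)
  moreover have "(\<lambda>j. b j * s ^ j) sums f (p + s *\<^sub>R u)" if s: "\<bar>s\<bar> < R" for s
  proof -
    have "\<bar>s\<bar> * norm u \<le> \<bar>s\<bar> * (norm u + 1)" by (intro mult_left_mono) auto
    also have "\<dots> < r" using s nu by (simp add: R_def field_simps)
    finally have "p + s *\<^sub>R u \<in> ball p r" by (simp add: dist_norm)
    from c[OF this]
    have "((\<lambda>k. c k * (s ^ sum k Basis * monomial k u)) has_sum f (p + s *\<^sub>R u)) multi_indices"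
      by (simp add: monomial_scaleR)
    also have "?this \<longleftrightarrow> ((\<lambda>(j, k). c k * monomial k u * s ^ j) has_sum f (p + s *\<^sub>R u)) (Sigma UNIV M)"
      by (rule has_sum_reindex_bij_witness[where i = snd and j = "\<lambda>k. (sum k Basis, k)"])
        (auto simp: M_def)
    finally have "((\<lambda>j. b j * s ^ j) has_sum f (p + s *\<^sub>R u)) UNIV"
    proof (rule has_sum_SigmaD)
      fix j
      show "((\<lambda>k. case (j, k) of (j, k) \<Rightarrow> c k * monomial k u * s ^ j) has_sum b j * s ^ j) (M j)"
        using has_sum_finite[of "M j" "\<lambda>k. c k * monomial k u * s ^ j"]
        by (simp add: M_def finite_multi_indices_degree b_def sum_distrib_right)
    qed
    then show ?thesis by (rule has_sum_imp_sums)
  qed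
  ultimately show thesis by (rule that)
qed

text \<open>Either all coefficients of the power series at \<open>t0\<close> vanish, or
  \<open>t0\<close> has a punctured neighbourhood without zeros.\<close>

lemma real_analytic_line_local:
  assumes "real_analytic f"
  shows "(\<forall>\<^sub>F t in nhds t0. f (a + t *\<^sub>R u) = 0) \<or> (\<forall>\<^sub>F t in at t0. f (a + t *\<^sub>R u) \<noteq> 0)"
proof -
  define \<phi> where "\<phi> t = f (a + t *\<^sub>R u)" for t
  obtain R b where R: "R > 0" and "\<And>s. \<bar>s\<bar> < R \<Longrightarrow> (\<lambda>j. b j * s ^ j) sums f (a + t0 *\<^sub>R u + s *\<^sub>R u)"
    using real_analytic_line_powser[of f "a + t0 *\<^sub>R u" u] assms unfolding real_analytic_def by blast
  then have "(\<lambda>j. b j * (t - t0) ^ j) sums f (a + t0 *\<^sub>R u + (t - t0) *\<^sub>R u)" if "\<bar>t - t0\<bar> < R" for t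
    using that by blast
  then have b: "(\<lambda>j. b j * (t - t0) ^ j) sums \<phi> t" if "\<bar>t - t0\<bar> < R" for t
    using that by (simp add: \<phi>_def algebra_simps)
  have b0: "b 0 = \<phi> t0" using b[of t0] R by (simp add: powser_sums_zero_iff)
  consider "\<phi> t0 \<noteq> 0" | "\<phi> t0 = 0" "\<forall>j. b j = 0" | j where "\<phi> t0 = 0" "b j \<noteq> 0" by blast
  then have "(\<forall>\<^sub>F t in nhds t0. \<phi> t = 0) \<or> (\<forall>\<^sub>F t in at t0. \<phi> t \<noteq> 0)"
  proof cases
    case 1
    have "((\<lambda>s. \<phi> (s + t0)) \<longlongrightarrow> b 0) (at 0)"
      using R b[of "s + t0" for s] by (intro powser_limit_0[of R]) auto
    then have "\<forall>\<^sub>F t in at 0. \<phi> (t + t0) \<noteq> 0"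
      by (rule tendsto_imp_eventually_ne) (use b0 1 in simp)
    then have "\<forall>\<^sub>F t in at t0. \<phi> t \<noteq> 0" by (subst eventually_at_to_0)
    then show ?thesis ..
  next
    case 2
    have "\<phi> t = 0" if "\<bar>t - t0\<bar> < R" for t
      using b[OF that] 2 sums_unique2[OF _ sums_zero] by force
    then show ?thesis
      using R by (auto simp: eventually_nhds_metric dist_real_def)
  next
    case (3 j)
    then have "j > 0" using b0 by (metis gr0I)
    obtain s where "s > 0" "\<And>z. z \<in> cball t0 s - {t0} \<Longrightarrow> \<phi> z \<noteq> 0"
      by (rule powser_0_nonzero[of R t0 b \<phi> j]) (use R b 3 \<open>j > 0\<close> in auto)
    then show ?thesis
      by (auto simp: eventually_at dist_commute intro!: exI[of _ s])
  qed
  then show ?thesis by (simp add: \<phi>_def)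
qed

text \<open>The points near which the function vanishes form an open and closed set
  \<open>U\<close>. If \<open>U\<close> is empty, the zeros have no limit point and are
  countable.\<close>

lemma real_analytic_line:
  assumes "real_analytic f"
  shows "(\<forall>t. f (a + t *\<^sub>R u) = 0) \<or> countable {t. f (a + t *\<^sub>R u) = 0}"
proof -
  define U where "U = {t. \<forall>\<^sub>F s in nhds t. f (a + s *\<^sub>R u) = 0}"
  have "open U"
    unfolding open_subopen[of U]
  proof
    fix t assume "t \<in> U"
    then obtain V where "open V" "t \<in> V" "\<forall>s\<in>V. f (a + s *\<^sub>R u) = 0"
      by (auto simp: U_def eventually_nhds)
    then show "\<exists>V. open V \<and> t \<in> V \<and> V \<subseteq> U" by (auto simp: U_def eventually_nhds)
  qed
  moreover have "open (- U)"
    unfolding open_subopen[of "- U"]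
  proof
    fix t assume t: "t \<in> - U"
    then have "\<forall>\<^sub>F s in at t. f (a + s *\<^sub>R u) \<noteq> 0"
      using real_analytic_line_local[OF assms] by (auto simp: U_def)
    then obtain V where V: "open V" "t \<in> V" "\<forall>s\<in>V. s \<noteq> t \<longrightarrow> f (a + s *\<^sub>R u) \<noteq> 0"
      by (auto simp: eventually_at_topological)
    have "s \<notin> U" if "s \<in> V" for s
    proof (cases "s = t")
      case False
      then show ?thesis using V that by (auto simp: U_def dest: eventually_nhds_x_imp_x)
    qed (use t in simp)
    then show "\<exists>V. open V \<and> t \<in> V \<and> V \<subseteq> - U" using V by blast
  qed
  ultimately have "U = {} \<or> U = UNIV"
    using connected_UNIV[where 'a = real] by (auto simp: connected_clopen closed_def Compl_eq_Diff_UNIV)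
  then show ?thesis
  proof
    assume "U = {}"
    then have "\<not> t islimpt {t. f (a + t *\<^sub>R u) = 0}" for t
      using real_analytic_line_local[OF assms, of a u t]
      by (auto simp: U_def islimpt_iff_eventually)
    then have "{t. f (a + t *\<^sub>R u) = 0} sparse_in UNIV" by (simp add: sparse_in_open)
    then show ?thesis using sparse_imp_countable[OF open_UNIV] by fastforce
  next
    assume "U = UNIV"
    then have "f (a + t *\<^sub>R u) = 0" for t
      using eventually_nhds_x_imp_x[of "\<lambda>t. f (a + t *\<^sub>R u) = 0" t] by (auto simp: U_def)
    then show ?thesis by blast
  qed
qed

text \<open>Coordinates are fixed one by one. Each \<open>g\<close> forbids only countably many
  values of the next coordinate, so countably many \<open>g\<close> leave some value in the unit
  interval.\<close>

lemma generic_positive_point: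
  fixes G :: "((nat \<Rightarrow> real) \<Rightarrow> real) set"
  assumes "countable G"
    and line: "\<And>g x i. g \<in> G \<Longrightarrow> (\<forall>t. g (x(i := t)) = 0) \<or> countable {t. g (x(i := t)) = 0}"
    and nonzero: "\<And>g. g \<in> G \<Longrightarrow> \<exists>x. g x \<noteq> 0"
    and local: "\<And>g x y. g \<in> G \<Longrightarrow> \<forall>i<n. x i = y i \<Longrightarrow> g x = g y"
  shows "\<exists>x. (\<forall>i<n. x i > 0) \<and> (\<forall>g\<in>G. g x \<noteq> 0)"
proof -
  \<comment> \<open>The invariant: for each \<open>g\<close> separately, the coordinates fixed so
    far extend to a point where \<open>g\<close> does not vanish.\<close>
  have "\<exists>x. (\<forall>i<m. x i > 0) \<and> (\<forall>g\<in>G. \<exists>y. (\<forall>i<m. x i = y i) \<and> g y \<noteq> 0)" for m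
  proof (induction m)
    case 0
    then show ?case using nonzero by simp
  next
    case (Suc m)
    then obtain x where x: "\<forall>i<m. x i > 0" "\<forall>g\<in>G. \<exists>y. (\<forall>i<m. x i = y i) \<and> g y \<noteq> 0" by blast
    then obtain y where y: "\<And>g i. g \<in> G \<Longrightarrow> i < m \<Longrightarrow> x i = y g i" "\<And>g. g \<in> G \<Longrightarrow> g (y g) \<noteq> 0"
      by metis
    define B where "B = (\<Union>g\<in>G. {t. g ((y g)(m := t)) = 0})"
    have "countable {t. g ((y g)(m := t)) = 0}" if "g \<in> G" for g
      using line[OF that, of "y g" m] y(2)[OF that] by (metis fun_upd_triv)
    then have "countable B" unfolding B_def using assms(1) by blast
    then have "\<not> {0<..<1} \<subseteq> B"
      using uncountable_open_interval[of 0 "1::real"] countable_subset by auto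
    then obtain t where t: "t > 0" "t \<notin> B"
      by (metis greaterThanLessThan_iff subsetI)
    show ?case
    proof (rule exI[of _ "x(m := t)"], intro conjI ballI)
      show "\<forall>i<Suc m. (x(m := t)) i > 0" using x t by (auto simp: less_Suc_eq)
      fix g assume g: "g \<in> G"
      show "\<exists>z. (\<forall>i<Suc m. (x(m := t)) i = z i) \<and> g z \<noteq> 0"
        using t g y(1)[OF g] by (intro exI[of _ "(y g)(m := t)"] conjI) (auto simp: B_def less_Suc_eq)
    qed
  qed
  then obtain x where "\<forall>i<n. x i > 0" "\<forall>g\<in>G. \<exists>y. (\<forall>i<n. x i = y i) \<and> g y \<noteq> 0" by blast
  then show ?thesis using local by metis
qed

section \<open>Generic projections of Hales-Jewett cubes\<close>

definition proj :: "(nat \<Rightarrow> 'a::real_vector) \<Rightarrow> nat list \<Rightarrow> (nat \<Rightarrow> real) \<Rightarrow> 'a" where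
  "proj \<tau> w x = (\<Sum>i<length w. x i *\<^sub>R \<tau> (w ! i))"

text \<open>Varying one scalar moves the point along a straight line, which makes
  \<open>real_analytic_line\<close> applicable.\<close>

lemma proj_upd:
  "proj \<tau> w (x(i := t)) = proj \<tau> w (x(i := 0)) + t *\<^sub>R (if i < length w then \<tau> (w ! i) else 0)"
proof -
  have "proj \<tau> w (x(i := t)) = (\<Sum>j<length w. (x(i := 0)) j *\<^sub>R \<tau> (w ! j) +
      (if j = i then t *\<^sub>R \<tau> (w ! i) else 0))"
    unfolding proj_def by (rule sum.cong) auto
  then show ?thesis by (simp add: sum.distrib proj_def)
qed

lemma proj_unit: "i < length w \<Longrightarrow> proj \<tau> w ((\<lambda>_. 0)(i := 1)) = \<tau> (w ! i)"
  by (subst proj_upd) (simp add: proj_def)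

lemma proj_local: "\<forall>i<length w. x i = y i \<Longrightarrow> proj \<tau> w x = proj \<tau> w y"
  by (simp add: proj_def)

text \<open>Fixed letters contribute the translation \<open>v\<close>, and the scalars at wildcards
  add up to the ratio \<open>c\<close>. It is positive because a wildcard occurs.\<close>

lemma homothetic_copy_proj_line:
  assumes P: "pattern k 1 n P" and x: "\<forall>i<n. x i > 0" and \<tau>: "\<tau> ` {..<k} = T"
  shows "homothetic_copy ((\<lambda>a. proj \<tau> (subst P [a]) x) ` {..<k}) T"
proof -
  have len: "length P = n" using P by (rule pattern_length)
  define v where "v = (\<Sum>i<n. case P ! i of Letter a \<Rightarrow> x i *\<^sub>R \<tau> a | Wild j \<Rightarrow> 0)"
  define c where "c = (\<Sum>i<n. case P ! i of Letter a \<Rightarrow> 0 | Wild j \<Rightarrow> x i)"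
  obtain i where i: "i < n" "P ! i = Wild 0"
    using P by (auto simp: pattern_def in_set_conv_nth)
  have "c > 0"
    unfolding c_def by (rule sum_pos2[of _ i]) (use i x in \<open>auto split: symb.split simp: less_imp_le\<close>)
  have "proj \<tau> (subst P [a]) x = v + c *\<^sub>R \<tau> a" for a
  proof -
    have "x i *\<^sub>R \<tau> (subst1 [a] (P ! i)) =
        (case P ! i of Letter a \<Rightarrow> x i *\<^sub>R \<tau> a | Wild j \<Rightarrow> 0) +
        (case P ! i of Letter a \<Rightarrow> 0 | Wild j \<Rightarrow> x i) *\<^sub>R \<tau> a" if "i < n" for i
    proof -
      have "symb_ok k 1 (P ! i)" using P that len by (auto simp: pattern_def)
      then show ?thesis by (cases "P ! i") auto
    qed
    then show ?thesis
      by (simp add: proj_def v_def c_def len subst_def sum.distrib scaleR_sum_left)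
  qed
  then have "(\<lambda>a. proj \<tau> (subst P [a]) x) ` {..<k} = (\<lambda>p. v + c *\<^sub>R p) ` T"
    unfolding \<tau>[symmetric] by (simp add: image_image)
  then show ?thesis using \<open>c > 0\<close> unfolding homothetic_copy_def homothetic_map_def by blast
qed

text \<open>Two kinds of functions of \<open>x\<close> must not vanish: the values of each
  \<open>f\<close> at pairs of points, and certain inner products with differences of points. The
  latter yield injectivity, so that densities of words become densities in \<open>X\<close>.\<close>

lemma generic_projection:
  fixes T :: "('a::euclidean_space) set"
  assumes "countable \<F>" "\<And>f. f \<in> \<F> \<Longrightarrow> real_analytic f" "family_respects \<F> T"
    and \<tau>: "bij_betw \<tau> {..<k} T"
  shows "\<exists>x. (\<forall>i<n. x i > 0) \<and> inj_on (\<lambda>w. proj \<tau> w x) (words k n) \<and>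
    family_respects \<F> ((\<lambda>w. proj \<tau> w x) ` words k n)"
proof -
  define W where "W = {(w, w') \<in> words k n \<times> words k n. w \<noteq> w'}"
  define g where "g f ww x = f (proj \<tau> (fst ww) x, proj \<tau> (snd ww) x)" for f :: "'a \<times> 'a \<Rightarrow> real" and ww x
  define h where "h ww e x = (proj \<tau> (fst ww) x - proj \<tau> (snd ww) x) \<bullet> e" for ww and e :: 'a and x
  define E where "E = (\<lambda>(p, q). p - q) ` (T \<times> T)"
  \<comment> \<open>Some \<open>e\<close> may be orthogonal to all differences for a given pair of
    words; only the functions that do not vanish identically can be avoided.\<close>
  define H where "H = {h ww e | ww e. ww \<in> W \<and> e \<in> E \<and> (\<exists>x. h ww e x \<noteq> 0)}"
  define G where "G = case_prod g ` (\<F> \<times> W) \<union> H"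
  have "finite T" using \<tau> bij_betw_finite by blast
  have "finite W" unfolding W_def by (rule finite_subset[of _ "words k n \<times> words k n"]) auto
  have diff: "\<exists>i<n. w ! i \<noteq> w' ! i \<and> \<tau> (w ! i) \<noteq> \<tau> (w' ! i) \<and> \<tau> (w ! i) \<in> T \<and> \<tau> (w' ! i) \<in> T"
    if "(w, w') \<in> W" for w w'
  proof -
    have w: "w \<in> words k n" "w' \<in> words k n" "w \<noteq> w'" using that by (auto simp: W_def)
    then obtain i where "i < n" "w ! i \<noteq> w' ! i" by (metis words_length nth_equalityI)
    then show ?thesis
      using w words_nth[of w k n i] words_nth[of w' k n i] \<tau>
      by (auto simp: bij_betw_def inj_on_def)
  qed
  have len: "length w = n" "length w' = n" if "(w, w') \<in> W" for w w'
    using that by (auto simp: W_def words_length)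
  have "\<exists>x. (\<forall>i<n. x i > 0) \<and> (\<forall>g\<in>G. g x \<noteq> 0)"
  proof (rule generic_positive_point)
    have "H \<subseteq> case_prod h ` (W \<times> E)" by (auto simp: H_def)
    moreover have "finite (W \<times> E)" using \<open>finite T\<close> \<open>finite W\<close> by (simp add: E_def)
    ultimately have "countable H"
      by (metis countable_finite finite_imageI finite_subset)
    then show "countable G"
      unfolding G_def using assms(1) \<open>finite W\<close> by (auto simp: countable_finite)
  next
    fix u x i assume "u \<in> G"
    then consider f w w' where "f \<in> \<F>" "u = g f (w, w')" | w w' e where "u = h (w, w') e"
      unfolding G_def H_def by auto
    then show "(\<forall>t. u (x(i := t)) = 0) \<or> countable {t. u (x(i := t)) = 0}"
    proof cases
      case 1
      have "u (x(i := t)) = f ((proj \<tau> w (x(i := 0)), proj \<tau> w' (x(i := 0))) +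
          t *\<^sub>R (if i < length w then \<tau> (w ! i) else 0, if i < length w' then \<tau> (w' ! i) else 0))" for t
        unfolding 1(2) g_def fst_conv snd_conv by (subst (1 2) proj_upd) (simp add: scaleR_prod_def)
      then show ?thesis
        by (simp only: real_analytic_line[OF assms(2)[OF 1(1)]])
    next
      case 2
      define \<beta> where "\<beta> = ((if i < length w then \<tau> (w ! i) else 0) - (if i < length w' then \<tau> (w' ! i) else 0)) \<bullet> e"
      have u: "u (x(i := t)) = u (x(i := 0)) + t * \<beta>" for t
        unfolding 2 h_def fst_conv snd_conv \<beta>_def
        by (subst (1 2) proj_upd) (simp add: inner_diff_left inner_add_left algebra_simps)
      show ?thesis
      proof (cases "\<beta> = 0")
        case True
        then have "u (x(i := t)) = u (x(i := 0))" for t using u[of t] by simp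
        then show ?thesis by (metis (mono_tags, lifting) countable_empty empty_Collect_eq)
      next
        case False
        have "{t. u (x(i := t)) = 0} \<subseteq> {- u (x(i := 0)) / \<beta>}"
          by (subst u) (use False in \<open>auto simp: field_simps\<close>)
        then show ?thesis by (metis countable_empty countable_insert countable_subset)
      qed
    qed
  next
    fix u assume "u \<in> G"
    then consider f w w' where "f \<in> \<F>" "(w, w') \<in> W" "u = g f (w, w')" | "\<exists>x. u x \<noteq> 0"
      unfolding G_def H_def by auto
    then show "\<exists>x. u x \<noteq> 0"
    proof cases
      case 1
      obtain i where i: "i < n" "\<tau> (w ! i) \<noteq> \<tau> (w' ! i)" "\<tau> (w ! i) \<in> T" "\<tau> (w' ! i) \<in> T"
        using diff[OF 1(2)] by blast
      have "u ((\<lambda>_. 0)(i := 1)) = f (\<tau> (w ! i), \<tau> (w' ! i))"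
        using i len[OF 1(2)] by (simp add: 1(3) g_def proj_unit)
      then show ?thesis using assms(3) 1(1) i unfolding family_respects_def by metis
    qed
  next
    fix u x y assume u: "u \<in> G" and xy: "\<forall>i<n. x i = (y i :: real)"
    then have "proj \<tau> w x = proj \<tau> w y" "proj \<tau> w' x = proj \<tau> w' y" if "(w, w') \<in> W" for w w'
      using len[OF that] by (auto intro: proj_local)
    then show "u x = u y" using u by (auto simp: G_def H_def g_def h_def)
  qed
  then obtain x where x: "\<forall>i<n. x i > 0" "\<And>u. u \<in> G \<Longrightarrow> u x \<noteq> 0" by blast
  have neq: "proj \<tau> w x \<noteq> proj \<tau> w' x" if ww: "(w, w') \<in> W" for w w'
  proof -
    obtain i where i: "i < n" "\<tau> (w ! i) \<noteq> \<tau> (w' ! i)" "\<tau> (w ! i) \<in> T" "\<tau> (w' ! i) \<in> T"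
      using diff[OF ww] by blast
    \<comment> \<open>At a unit vector this choice of \<open>e\<close> gives the squared norm of
      \<open>e\<close>, so the function belongs to \<open>H\<close>.\<close>
    let ?e = "\<tau> (w ! i) - \<tau> (w' ! i)"
    have "h (w, w') ?e ((\<lambda>_. 0)(i := 1)) = ?e \<bullet> ?e"
      using i len[OF ww] by (simp add: h_def proj_unit)
    then have "h (w, w') ?e ((\<lambda>_. 0)(i := 1)) \<noteq> 0" using i(2) by simp
    moreover have "?e \<in> E" using i by (force simp: E_def)
    ultimately have "h (w, w') ?e \<in> G" using ww unfolding G_def H_def by blast
    from x(2)[OF this] show ?thesis by (auto simp: h_def)
  qed
  have "f (p, q) \<noteq> 0" if pq: "f \<in> \<F>" "p \<in> (\<lambda>w. proj \<tau> w x) ` words k n"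
    "q \<in> (\<lambda>w. proj \<tau> w x) ` words k n" "p \<noteq> q" for f p q
  proof -
    obtain w w' where w: "p = proj \<tau> w x" "q = proj \<tau> w' x" "w \<in> words k n" "w' \<in> words k n"
      using pq by blast
    then have "(w, w') \<in> W" using pq(4) by (auto simp: W_def)
    then have "g f (w, w') \<in> G" using pq(1) by (force simp: G_def)
    from x(2)[OF this] show ?thesis by (simp add: g_def w)
  qed
  moreover have "inj_on (\<lambda>w. proj \<tau> w x) (words k n)"
    using neq by (auto simp: inj_on_def W_def)
  ultimately show ?thesis using x(1) unfolding family_respects_def by blast
qed

section \<open>From dense sets of words to dense subsets of the projected cube\<close>

theorem theorem7:
  fixes T :: "(real ^ 'd) set"
    and \<F> :: "((real ^ 'd) \<times> (real ^ 'd) \<Rightarrow> real) set"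
    and \<alpha> :: real
  assumes "finite T"
    and "countable \<F>"
    and "\<And>f. f \<in> \<F> \<Longrightarrow> real_analytic f"
    and "family_respects \<F> T"
    and "\<alpha> > 0"
  shows "\<exists>X :: (real ^ 'd) set. finite X \<and> family_respects \<F> X \<and>
           (\<forall>Y. Y \<subseteq> X \<and> real (card Y) \<ge> \<alpha> * real (card X) \<longrightarrow>
              (\<exists>T'. homothetic_copy T' T \<and> T' \<subseteq> Y))"
proof (cases "T = {}")
  case True
  \<comment> \<open>With \<open>T\<close> empty there are no letters; the empty set serves as
    \<open>X\<close> and as the copy.\<close>
  have "homothetic_copy {} T"
    unfolding homothetic_copy_def homothetic_map_def True by (auto intro!: exI[of _ 1])
  then show ?thesis by (intro exI[of _ "{}"]) (auto simp: family_respects_def)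
next
  case False
  define k where "k = card T"
  have k: "k > 0" using assms(1) False by (simp add: k_def card_gt_0_iff)
  obtain \<tau> where \<tau>: "bij_betw \<tau> {..<k} T"
    using ex_bij_betw_nat_finite[OF assms(1)] by (auto simp: k_def atLeast0LessThan)
  obtain n where n: "\<And>A. dens k n A \<ge> \<alpha> \<Longrightarrow> \<exists>P. pattern k 1 n P \<and> (\<forall>a<k. A (subst P [a]))"
    using density_Hales_Jewett[OF k] assms(5) unfolding DHJ_def by (meson order_refl)
  obtain x where x: "\<forall>i<n. x i > 0" "inj_on (\<lambda>w. proj \<tau> w x) (words k n)"
    "family_respects \<F> ((\<lambda>w. proj \<tau> w x) ` words k n)"
    using generic_projection[OF assms(2-4) \<tau>] by blast
  define X where "X = (\<lambda>w. proj \<tau> w x) ` words k n"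
  have "\<exists>T'. homothetic_copy T' T \<and> T' \<subseteq> Y"
    if Y: "Y \<subseteq> X" "real (card Y) \<ge> \<alpha> * real (card X)" for Y
  proof -
    \<comment> \<open>By injectivity of the projection, the proportion of \<open>Y\<close> in
      \<open>X\<close> equals the density of \<open>?A\<close> among the words.\<close>
    let ?A = "{w \<in> words k n. proj \<tau> w x \<in> Y}"
    have "Y = (\<lambda>w. proj \<tau> w x) ` ?A" using Y(1) by (auto simp: X_def)
    then have "card Y = card ((\<lambda>w. proj \<tau> w x) ` ?A)" by (rule arg_cong)
    also have "\<dots> = card ?A" by (rule card_image, rule inj_on_subset[OF x(2)]) auto
    finally have "card Y = card ?A" .
    moreover have "card X = k ^ n" unfolding X_def by (subst card_image[OF x(2)]) simp
    ultimately have "dens k n (\<lambda>w. proj \<tau> w x \<in> Y) \<ge> \<alpha>"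
      using Y(2) k by (simp add: avg_def field_simps Int_def)
    from n[OF this] obtain P where P: "pattern k 1 n P" "\<forall>a<k. proj \<tau> (subst P [a]) x \<in> Y" by blast
    have "\<tau> ` {..<k} = T" using \<tau> by (simp add: bij_betw_def)
    from homothetic_copy_proj_line[OF P(1) x(1) this] P(2) show ?thesis by blast
  qed
  moreover have "finite X" by (simp add: X_def)
  ultimately show ?thesis using x(3) unfolding X_def by blast
qed

end
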